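(* Let $M\subset\mathbb{R}^3$ be open, and let a wildfire spread in $M$ under the constant wind $W=(0,W_2,W_3)$, the propagation being governed by the Randers metric $F$ with constant Zermelo data $(h;W)$. Let $A$ be the wavefront at time $0$. Then: (i) If all points of $M$ have the same priority, the strategic path is $\gamma_F(t)=p+tV$, provided that $p\in A$ and the squared Euclidean norm $v_1^2+v_2^2+v_3^2$ of $V=(v_1,v_2,v_3)$ is maximal among all vectors $V$ (over all base points $p\in A$) satisfying $|V-W|_h=1$ and $V-W$ $h$-orthogonal to $A$ at $p$. (ii) Given any point $q$, the strategic path that reaches $q$ is $\gamma_F(t)=q+(t-\tau)V$, where $|V-W|_h=1$, $V-W$ is $h$-orthogonal to $A$ (at the starting point $q-\tau V\in A$), and $\tau$ is the time of the wavefront to which $q$ belongs. (iii) Given any area $B\subset M$, the strategic path which reaches $B$ is $\gamma_F(t)=q+(t-\tau)V$ such that $|V-W|_h=1$, $V-W$ is $h$-orthogonal to $A$ (at the starting point $q-\tau V\in A$), where $\tau$ is the time of the wavefront that intersects $B$ for the first time and $q$ is the point of intersection.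
   Context: Zermelo data: for a Riemannian metric $h$ and a vector field $W$ with $h(W,W)<1$, the Randers metric with Zermelo data $(h;W)$ is $F(V)=\frac{\sqrt{h(W,V)^2+\lambda h(V,V)}-h(W,V)}{\lambda}$, $\lambda=1-h(W,W)$; equivalently $F$ is positively homogeneous and $F(V)=1$ iff $h(V-W,V-W)=1$. Write $|V|_h=\sqrt{h(V,V)}$. Here $W$ is constant and $h$ is constant, $h=\frac12\operatorname{Hess}Q_h$ with $Q_h(u,v,w)=(\frac{u}{a})^2+(\frac{v\cos\alpha-w\sin\alpha}{b})^2+(\frac{v\sin\alpha+w\cos\alpha}{c})^2$ for real constants $a,b,c>0$ and $\alpha$. Distance: $d(p,q)$ is the infimum of $\int_0^1F(\gamma'(t))dt$ over piecewise smooth curves in $M$ from $p$ to $q$; $d(A,q)=\inf_{p\in A}d(p,q)$ and $\rho(q)=d(A,q)$. An $F$-geodesic is a smooth curve that is locally the shortest-time path between nearby points on it; unit speed means $F(\gamma')=1$. Fire model: the fire starts at time $0$ from $A$, a compact smooth submanifold of $M$ (possibly a point). The wavefront at time $\tau$ is $\rho^{-1}(\tau)$. A wave ray from $A$ is a unit-speed shortest-time path from $A$: $\gamma(0)\in A$ and $d(A,\gamma(t))=t$ for the times considered. Strategic paths (there may be more than one): if all points of $M$ have the same priority, a strategic path is a wave ray along which the fire advances most, i.e. one whose Euclidean velocity is maximal among all wave rays from $A$. For a given point $q$, a strategic path is a wave ray from $A$ that reaches $q$ (at the time $\tau$ of the wavefront containing $q$). For a given area $B$, it is a wave ray from $A$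 along which the fire meets $B$ (its frontier) for the first time. Standing assumption (the fire is stopped before cut loci or singularities appear): all times lie in $(0,r]$, where $r$ is such that every unit-speed $F$-geodesic leaving $A$ $F$-orthogonally is defined in $M$ on $[0,r]$ and satisfies $d(A,\gamma(t))=t$ there, and every $q$ with $0<\rho(q)\le r$ is reached by exactly one such geodesic at time $\rho(q)$. A nonzero $V$ is $F$-orthogonal to $A$ if $g_V(V,U)=0$ for all $U$ tangent to $A$, with $g_V(V,U)=\frac12\frac{\partial^2}{\partial t\partial s}F^2(V+tV+sU)|_{s=t=0}$; $X$ is $h$-orthogonal to $A$ at $p$ if $h(X,U)=0$ for all $U\in T_pA$. *)

theory Defs
  imports "HOL-Analysis.Analysis"
begin

section \<open>Smoothness, curves and submanifolds\<close>

text \<open>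
  On an open set \<open>S\<close> the following is the usual notion of class \<open>C\<^sup>n\<close>, resp. \<open>C\<^sup>\<infinity>\<close>.
\<close>

primrec Cn_on :: "nat \<Rightarrow> 'a::real_normed_vector set \<Rightarrow> ('a \<Rightarrow> 'b::real_normed_vector) \<Rightarrow> bool" where
  "Cn_on 0 S f \<longleftrightarrow> continuous_on S f"
| "Cn_on (Suc n) S f \<longleftrightarrow> (\<forall>x\<in>S. f differentiable (at x)) \<and>
     (\<forall>v. Cn_on n S (\<lambda>x. frechet_derivative f (at x) v))"

definition smooth_on :: "'a::real_normed_vector set \<Rightarrow> ('a \<Rightarrow> 'b::real_normed_vector) \<Rightarrow> bool" where
  "smooth_on S f \<longleftrightarrow> (\<forall>n. Cn_on n S f)"

text \<open>
  Smoothness on a compact interval means having a smooth extension to a neighbourhood.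
\<close>

definition smooth_curve :: "real \<Rightarrow> real \<Rightarrow> (real \<Rightarrow> real^3) \<Rightarrow> bool" where
  "smooth_curve a b \<gamma> \<longleftrightarrow>
     (\<exists>U g. open U \<and> {a..b} \<subseteq> U \<and> smooth_on U g \<and> (\<forall>t\<in>{a..b}. g t = \<gamma> t))"

text \<open>
  Each piece has to be smooth up to its end points. (With the weaker requirement of
  \<^const>\<open>piecewise_C1_differentiable_on\<close> the length integral below need not exist, and
  \<^const>\<open>integral\<close> would then return 0.)
\<close>

definition piecewise_smooth :: "real \<Rightarrow> real \<Rightarrow> (real \<Rightarrow> real^3) \<Rightarrow> bool" where
  "piecewise_smooth a b \<gamma> \<longleftrightarrow> continuous_on {a..b} \<gamma> \<and>
     (\<exists>S. finite S \<and>
       (\<forall>u v. a \<le> u \<and> u < v \<and> v \<le> b \<and> {u<..<v} \<inter> S = {} \<longrightarrow> smooth_curve u v \<gamma>))"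

text \<open>Embedded submanifolds (without boundary) of \<open>M\<close>, described by slice charts.\<close>

definition smooth_submanifold :: "(real^3) set \<Rightarrow> (real^3) set \<Rightarrow> bool" where
  "smooth_submanifold M A \<longleftrightarrow> A \<subseteq> M \<and>
     (\<exists>k. \<forall>p\<in>A. \<exists>U U' (\<phi> :: real^3 \<Rightarrow> real^3) \<psi> (S :: (real^3) set).
        open U \<and> p \<in> U \<and> open U' \<and> homeomorphism U U' \<phi> \<psi> \<and>
        smooth_on U \<phi> \<and> smooth_on U' \<psi> \<and>
        subspace S \<and> dim S = k \<and> \<phi> ` (U \<inter> A) = U' \<inter> S)"

definition tangent_space :: "(real^3) set \<Rightarrow> real^3 \<Rightarrow> (real^3) set" where
  "tangent_space A p = {u. \<exists>\<epsilon>>0. \<exists>c. smooth_on {-\<epsilon><..<\<epsilon>} c \<and> c ` {-\<epsilon><..<\<epsilon>} \<subseteq> A \<and>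
     c 0 = p \<and> (c has_vector_derivative u) (at 0)}"

section \<open>The Randers metric with constant Zermelo data\<close>

definition half_hessian :: "(real^3 \<Rightarrow> real) \<Rightarrow> real^3 \<Rightarrow> real^3 \<Rightarrow> real^3 \<Rightarrow> real" where
  "half_hessian f x u v =
     1/2 * deriv (\<lambda>t. deriv (\<lambda>s. f (x + t *\<^sub>R u + s *\<^sub>R v)) 0) 0"

definition Q_h :: "real \<Rightarrow> real \<Rightarrow> real \<Rightarrow> real \<Rightarrow> real^3 \<Rightarrow> real" where
  "Q_h a b c \<alpha> x = (x$1 / a)^2 + ((x$2 * cos \<alpha> - x$3 * sin \<alpha>) / b)^2
     + ((x$2 * sin \<alpha> + x$3 * cos \<alpha>) / c)^2"

text \<open>
  The Hessian of the quadratic form \<open>Q_h\<close> is the same at every point (lemma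
  \<open>half_hessian_Q_h\<close> below), so the base point 0 is immaterial.
\<close>

definition ellipsoid_metric :: "real \<Rightarrow> real \<Rightarrow> real \<Rightarrow> real \<Rightarrow> real^3 \<Rightarrow> real^3 \<Rightarrow> real" where
  "ellipsoid_metric a b c \<alpha> = half_hessian (Q_h a b c \<alpha>) 0"

lemma half_hessian_Q_h:
  "half_hessian (Q_h a b c \<alpha>) x u v =
     (u$1 / a) * (v$1 / a)
     + ((u$2 * cos \<alpha> - u$3 * sin \<alpha>) / b) * ((v$2 * cos \<alpha> - v$3 * sin \<alpha>) / b)
     + ((u$2 * sin \<alpha> + u$3 * cos \<alpha>) / c) * ((v$2 * sin \<alpha> + v$3 * cos \<alpha>) / c)"
proof -
  define l1 l2 l3 :: "real^3 \<Rightarrow> real" where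
    "l1 = (\<lambda>x. x$1 / a)" and
    "l2 = (\<lambda>x. (x$2 * cos \<alpha> - x$3 * sin \<alpha>) / b)" and
    "l3 = (\<lambda>x. (x$2 * sin \<alpha> + x$3 * cos \<alpha>) / c)"
  note l_defs = l1_def l2_def l3_def
  have lin: "l (x + t *\<^sub>R u + s *\<^sub>R v) = l x + t * l u + s * l v"
    if "l = l1 \<or> l = l2 \<or> l = l3" for l t s
    using that by (auto simp: l_defs add_divide_distrib diff_divide_distrib algebra_simps)
  have Q: "Q_h a b c \<alpha> (x + t *\<^sub>R u + s *\<^sub>R v) =
      (l1 x + t * l1 u + s * l1 v)^2 + (l2 x + t * l2 u + s * l2 v)^2
      + (l3 x + t * l3 u + s * l3 v)^2" for t s
    unfolding lin[symmetric, of l1, simplified] lin[symmetric, of l2, simplified]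
      lin[symmetric, of l3, simplified] Q_h_def
    by (simp add: l_defs)
  have "deriv (\<lambda>s. Q_h a b c \<alpha> (x + t *\<^sub>R u + s *\<^sub>R v)) 0 =
      2 * (l1 x + t * l1 u) * l1 v + 2 * (l2 x + t * l2 u) * l2 v
      + 2 * (l3 x + t * l3 u) * l3 v" for t
    unfolding Q by (rule DERIV_imp_deriv) (auto intro!: derivative_eq_intros simp: algebra_simps)
  moreover have "deriv (\<lambda>t. 2 * (l1 x + t * l1 u) * l1 v + 2 * (l2 x + t * l2 u) * l2 v
      + 2 * (l3 x + t * l3 u) * l3 v) 0 = 2 * (l1 u * l1 v + l2 u * l2 v + l3 u * l3 v)"
    by (rule DERIV_imp_deriv) (auto intro!: derivative_eq_intros simp: algebra_simps)
  ultimately have "half_hessian (Q_h a b c \<alpha>) x u v = l1 u * l1 v + l2 u * l2 v + l3 u * l3 v"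
    by (simp add: half_hessian_def)
  then show ?thesis
    by (simp only: l_defs)
qed

definition randers :: "(real^3 \<Rightarrow> real^3 \<Rightarrow> real) \<Rightarrow> real^3 \<Rightarrow> real^3 \<Rightarrow> real" where
  "randers h W V =
     (let l = 1 - h W W in (sqrt ((h W V)^2 + l * h V V) - h W V) / l)"

definition h_norm :: "(real^3 \<Rightarrow> real^3 \<Rightarrow> real) \<Rightarrow> real^3 \<Rightarrow> real" where
  "h_norm h V = sqrt (h V V)"

definition h_orthogonal ::
  "(real^3 \<Rightarrow> real^3 \<Rightarrow> real) \<Rightarrow> (real^3) set \<Rightarrow> real^3 \<Rightarrow> real^3 \<Rightarrow> bool" where
  "h_orthogonal h A p X \<longleftrightarrow> (\<forall>u\<in>tangent_space A p. h X u = 0)"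

definition F_orthogonal ::
  "(real^3 \<Rightarrow> real) \<Rightarrow> (real^3) set \<Rightarrow> real^3 \<Rightarrow> real^3 \<Rightarrow> bool" where
  "F_orthogonal F A p V \<longleftrightarrow> V \<noteq> 0 \<and>
     (\<forall>u\<in>tangent_space A p. half_hessian (\<lambda>x. (F x)^2) V V u = 0)"

section \<open>Travel times, geodesics and wave rays\<close>

definition travel_time ::
  "(real^3 \<Rightarrow> real) \<Rightarrow> real \<Rightarrow> real \<Rightarrow> (real \<Rightarrow> real^3) \<Rightarrow> real" where
  "travel_time F a b \<gamma> = integral {a..b} (\<lambda>t. F (vector_derivative \<gamma> (at t within {a..b})))"

text \<open>
  Distances are extended reals: \<open>M\<close> need not be connected, and the infimum over the empty
  set of curves is \<open>\<infinity>\<close>.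
\<close>

definition F_dist ::
  "(real^3) set \<Rightarrow> (real^3 \<Rightarrow> real) \<Rightarrow> real^3 \<Rightarrow> real^3 \<Rightarrow> ereal" where
  "F_dist M F p q = (INF \<gamma> \<in> {\<gamma>. piecewise_smooth 0 1 \<gamma> \<and> \<gamma> ` {0..1} \<subseteq> M \<and> \<gamma> 0 = p \<and> \<gamma> 1 = q}.
     ereal (travel_time F 0 1 \<gamma>))"

definition arrival_time ::
  "(real^3) set \<Rightarrow> (real^3 \<Rightarrow> real) \<Rightarrow> (real^3) set \<Rightarrow> real^3 \<Rightarrow> ereal" where
  "arrival_time M F A q = (INF p\<in>A. F_dist M F p q)"

definition wavefront ::
  "(real^3) set \<Rightarrow> (real^3 \<Rightarrow> real) \<Rightarrow> (real^3) set \<Rightarrow> real \<Rightarrow> (real^3) set" where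
  "wavefront M F A \<tau> = {q\<in>M. arrival_time M F A q = ereal \<tau>}"

definition unit_speed ::
  "(real^3 \<Rightarrow> real) \<Rightarrow> real \<Rightarrow> (real \<Rightarrow> real^3) \<Rightarrow> bool" where
  "unit_speed F T \<gamma> \<longleftrightarrow> (\<forall>t\<in>{0..T}. \<forall>v.
     (\<gamma> has_vector_derivative v) (at t within {0..T}) \<longrightarrow> F v = 1)"

definition F_geodesic ::
  "(real^3) set \<Rightarrow> (real^3 \<Rightarrow> real) \<Rightarrow> real \<Rightarrow> (real \<Rightarrow> real^3) \<Rightarrow> bool" where
  "F_geodesic M F T \<gamma> \<longleftrightarrow> smooth_curve 0 T \<gamma> \<and> \<gamma> ` {0..T} \<subseteq> M \<and>
     (\<forall>t\<in>{0..T}. \<exists>\<delta>>0. \<forall>s\<in>{0..T}. \<forall>u\<in>{0..T}.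
        s \<le> u \<and> \<bar>s - t\<bar> < \<delta> \<and> \<bar>u - t\<bar> < \<delta> \<longrightarrow>
        F_dist M F (\<gamma> s) (\<gamma> u) = ereal (travel_time F s u \<gamma>))"

definition orthogonal_geodesic ::
  "(real^3) set \<Rightarrow> (real^3 \<Rightarrow> real) \<Rightarrow> (real^3) set \<Rightarrow> real \<Rightarrow> (real \<Rightarrow> real^3) \<Rightarrow> bool" where
  "orthogonal_geodesic M F A T \<gamma> \<longleftrightarrow> F_geodesic M F T \<gamma> \<and> unit_speed F T \<gamma> \<and> \<gamma> 0 \<in> A \<and>
     F_orthogonal F A (\<gamma> 0) (vector_derivative \<gamma> (at 0 within {0..T}))"

text \<open>
  The first conjunct says that any orthogonal unit speed geodesic defined
  on some initial interval \<open>[0,\<epsilon>]\<close> continues (or restricts) to one on \<open>[0,r]\<close> that realises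
  the arrival time. In the second one, curves are identified when they agree on \<open>[0,r]\<close>.
\<close>

definition no_cut_locus ::
  "(real^3) set \<Rightarrow> (real^3 \<Rightarrow> real) \<Rightarrow> (real^3) set \<Rightarrow> real \<Rightarrow> bool" where
  "no_cut_locus M F A r \<longleftrightarrow>
     (\<forall>\<epsilon>>0. \<forall>\<gamma>. orthogonal_geodesic M F A \<epsilon> \<gamma> \<longrightarrow>
        (\<exists>\<sigma>. orthogonal_geodesic M F A r \<sigma> \<and> (\<forall>t\<in>{0..min \<epsilon> r}. \<sigma> t = \<gamma> t) \<and>
             (\<forall>t\<in>{0..r}. arrival_time M F A (\<sigma> t) = ereal t))) \<and>
     (\<forall>\<tau> q. 0 < \<tau> \<and> \<tau> \<le> r \<and> q \<in> wavefront M F A \<tau> \<longrightarrow>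
        (\<exists>\<gamma>. orthogonal_geodesic M F A r \<gamma> \<and> \<gamma> \<tau> = q \<and>
             (\<forall>\<sigma>. orthogonal_geodesic M F A r \<sigma> \<and> \<sigma> \<tau> = q \<longrightarrow> (\<forall>t\<in>{0..r}. \<sigma> t = \<gamma> t))))"

definition wave_ray ::
  "(real^3) set \<Rightarrow> (real^3 \<Rightarrow> real) \<Rightarrow> (real^3) set \<Rightarrow> real \<Rightarrow> (real \<Rightarrow> real^3) \<Rightarrow> bool" where
  "wave_ray M F A T \<gamma> \<longleftrightarrow> piecewise_smooth 0 T \<gamma> \<and> \<gamma> ` {0..T} \<subseteq> M \<and> unit_speed F T \<gamma> \<and>
     \<gamma> 0 \<in> A \<and> (\<forall>t\<in>{0..T}. arrival_time M F A (\<gamma> t) = ereal t)"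

section \<open>Strategic paths\<close>

text \<open>
  Euclidean velocities are compared at equal times, wherever both curves have a velocity.
\<close>

definition strategic_path ::
  "(real^3) set \<Rightarrow> (real^3 \<Rightarrow> real) \<Rightarrow> (real^3) set \<Rightarrow> real \<Rightarrow> (real \<Rightarrow> real^3) \<Rightarrow> bool" where
  "strategic_path M F A T \<gamma> \<longleftrightarrow> wave_ray M F A T \<gamma> \<and>
     (\<forall>\<sigma>. wave_ray M F A T \<sigma> \<longrightarrow> (\<forall>t\<in>{0..T}. \<forall>v w.
        (\<gamma> has_vector_derivative v) (at t within {0..T}) \<and>
        (\<sigma> has_vector_derivative w) (at t within {0..T}) \<longrightarrow> norm w \<le> norm v))"

definition strategic_path_to_point ::
  "(real^3) set \<Rightarrow> (real^3 \<Rightarrow> real) \<Rightarrow> (real^3) set \<Rightarrow> real^3 \<Rightarrow> real \<Rightarrow> (real \<Rightarrow> real^3) \<Rightarrow> bool" where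
  "strategic_path_to_point M F A q \<tau> \<gamma> \<longleftrightarrow>
     q \<in> wavefront M F A \<tau> \<and> wave_ray M F A \<tau> \<gamma> \<and> \<gamma> \<tau> = q"

text \<open>
  The contact point is taken in the frontier of \<open>B\<close>, since \<open>B\<close> need not be closed: an open area
  has no first contact point in itself.
\<close>

definition first_contact ::
  "(real^3) set \<Rightarrow> (real^3 \<Rightarrow> real) \<Rightarrow> (real^3) set \<Rightarrow> (real^3) set \<Rightarrow> real \<Rightarrow> bool" where
  "first_contact M F A B \<tau> \<longleftrightarrow> wavefront M F A \<tau> \<inter> frontier B \<noteq> {} \<and>
     (\<forall>s. 0 \<le> s \<and> s < \<tau> \<longrightarrow> wavefront M F A s \<inter> B = {})"

definition strategic_path_to_area ::
  "(real^3) set \<Rightarrow> (real^3 \<Rightarrow> real) \<Rightarrow> (real^3) set \<Rightarrow> (real^3) set \<Rightarrow> real \<Rightarrow> (real \<Rightarrow> real^3) \<Rightarrow> bool" where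
  "strategic_path_to_area M F A B \<tau> \<gamma> \<longleftrightarrow>
     first_contact M F A B \<tau> \<and> wave_ray M F A \<tau> \<gamma> \<and> \<gamma> \<tau> \<in> frontier B"

end

theory Submission
  imports Defs
begin

text \<open>
  A linear map \<open>L\<close> turns the constant metric \<open>h\<close> into the Euclidean inner product, and
  \<open>F v \<le> \<tau>\<close> holds exactly if \<open>|L (v - \<tau> W)| \<le> \<tau>\<close>: a displacement \<open>v\<close> takes time at
  most \<open>\<tau>\<close> if, after subtracting the drift \<open>\<tau> W\<close>, its \<open>h\<close>-length is at most \<open>\<tau>\<close>
  (lemma \<open>F_le_iff\<close>). So, seen from the drifting frame, everything is Euclidean geometry: a curve with
  travel time \<open>\<tau>\<close> has \<open>h\<close>-length \<open>\<tau>\<close> in a frame moved by \<open>\<tau> W\<close>, which shows that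
  segments inside \<open>M\<close> are shortest (\<open>travel_time_ge\<close>, \<open>F_dist_segment\<close>).

  The heart of the matter is that, up to the cut locus, the wave rays are precisely the lines
  \<open>p + t V\<close> with \<open>p \<in> A\<close>, \<open>|V - W|\<^sub>h = 1\<close> and \<open>V - W\<close> \<open>h\<close>-orthogonal to \<open>A\<close>
  (\<open>wave_ray_iff_orthogonal_line\<close>). A wave ray has unit speed and cannot be shortened by a short
  segment, so in the drifting frame it is locally an isometry of the line, hence affine by strict convexity
  (\<open>wave_ray_affine\<close>). For small \<open>t\<close> its starting point minimizes the \<open>h\<close>-distance from the
  points of \<open>A\<close> nearby to \<open>p + t V - t W\<close>, and the first variation gives orthogonality
  (\<open>wave_ray_orthogonal\<close>). Conversely, an orthogonal line is an \<open>F\<close>-orthogonal geodesic for a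
  short time, because \<open>h (V - W) u = 0\<close> implies that \<open>u\<close> is orthogonal to \<open>V\<close> for the fundamental
  form of \<open>F\<close> (\<open>fundamental_form_orthogonal\<close>). The absence of cut points extends it to a wave
  ray up to time \<open>r\<close>, which is affine by the first half and so is the line itself
  (\<open>orthogonal_line_no_cut_locus\<close>).

  The strategic paths are then read off: the velocity of a wave ray is its constant \<open>V\<close>, the
  starting point of a ray that is at \<open>q\<close> at time \<open>\<tau>\<close> is \<open>q - \<tau> V\<close>, and uniqueness of the ray
  through \<open>q\<close> is that of the geodesic.
\<close>

section \<open>Smooth and piecewise smooth curves\<close>

lemma frechet_derivative_cong_open:
  assumes "open S" "x \<in> S" "\<And>y. y \<in> S \<Longrightarrow> f y = g y"
  shows "frechet_derivative f (at x) = frechet_derivative g (at x)"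
proof -
  have "(f has_derivative D) (at x) \<longleftrightarrow> (g has_derivative D) (at x)" for D
    using has_derivative_transform_within_open[OF _ assms(1,2), of f D UNIV g]
      has_derivative_transform_within_open[OF _ assms(1,2), of g D UNIV f] assms(3)
    by auto
  then show ?thesis
    by (simp add: frechet_derivative_def)
qed

text \<open>
  Frechet derivatives only see a neighbourhood, so an equality known on an open set can be pushed
  through all the iterated derivatives in \<^const>\<open>Cn_on\<close>.
\<close>

lemma Cn_on_cong:
  assumes "open S" "\<And>x. x \<in> S \<Longrightarrow> f x = g x" "Cn_on n S f"
  shows "Cn_on n S g"
  using assms(2,3)
proof (induction n arbitrary: f g)
  case 0
  then show ?case
    by (auto cong: continuous_on_cong)
next
  case (Suc n)
  have "g differentiable (at x)" if "x \<in> S" for x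
  proof -
    have "f differentiable (at x)"
      using Suc.prems(2) that by simp
    then show ?thesis
      unfolding differentiable_def
      using has_derivative_transform_within_open[OF _ assms(1) that, of f _ UNIV g] Suc.prems(1)
      by blast
  qed
  moreover have "Cn_on n S (\<lambda>x. frechet_derivative g (at x) v)" for v
  proof (rule Suc.IH)
    show "Cn_on n S (\<lambda>x. frechet_derivative f (at x) v)"
      using Suc.prems(2) by simp
    show "frechet_derivative f (at x) v = frechet_derivative g (at x) v" if "x \<in> S" for x
      using frechet_derivative_cong_open[OF assms(1) that, of f g] Suc.prems(1) by simp
  qed
  ultimately show ?case
    by simp
qed

lemma Cn_on_const: "Cn_on n S (\<lambda>x. c)"
  by (induction n arbitrary: c) auto

lemma Cn_on_compose_affine:
  fixes f :: "real \<Rightarrow> 'b::real_normed_vector"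
  assumes "open U" "Cn_on n U f"
  shows "Cn_on n {t. k * t + d \<in> U} (\<lambda>t. f (k * t + d))"
  using assms(2)
proof (induction n arbitrary: f)
  case 0
  have "continuous_on {t. k * t + d \<in> U} (f \<circ> (\<lambda>t. k * t + d))"
    by (rule continuous_on_compose) (use 0 in \<open>auto intro!: continuous_intros elim: continuous_on_subset\<close>)
  then show ?case
    by (simp add: o_def)
next
  case (Suc n)
  have open_pre: "open {t. k * t + d \<in> U}"
    using open_vimage[OF assms(1), of "\<lambda>t. k * t + d"]
    by (simp add: vimage_def continuous_intros)
  have der: "((\<lambda>t. f (k * t + d)) has_derivative
      (\<lambda>v. frechet_derivative f (at (k * t + d)) (k * v))) (at t)" if "k * t + d \<in> U" for t
  proof -
    have f: "(f has_derivative frechet_derivative f (at (k * t + d))) (at (k * t + d))"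
      using Suc.prems that frechet_derivative_works by auto
    have "((\<lambda>t. k * t + d) has_derivative (\<lambda>v. k * v)) (at t)"
      by (auto intro!: derivative_eq_intros)
    from diff_chain_at[OF this f] show ?thesis
      by (simp add: o_def)
  qed
  have "Cn_on n {t. k * t + d \<in> U} (\<lambda>t. frechet_derivative (\<lambda>t. f (k * t + d)) (at t) v)" for v
  proof (rule Cn_on_cong[OF open_pre])
    show "Cn_on n {t. k * t + d \<in> U} (\<lambda>t. frechet_derivative f (at (k * t + d)) (k * v))"
      using Suc.IH[of "\<lambda>x. frechet_derivative f (at x) (k * v)"] Suc.prems by simp
    show "frechet_derivative f (at (k * t + d)) (k * v) =
        frechet_derivative (\<lambda>t. f (k * t + d)) (at t) v" if "t \<in> {t. k * t + d \<in> U}" for t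
      using frechet_derivative_at[OF der, of t] that by (metis mem_Collect_eq)
  qed
  moreover have "(\<lambda>t. f (k * t + d)) differentiable (at t)" if "k * t + d \<in> U" for t
    using der[OF that] by (auto simp: differentiable_def)
  ultimately show ?case
    by simp
qed

lemma smooth_on_affine: "smooth_on UNIV (\<lambda>t::real. p + t *\<^sub>R V)"
proof -
  have der: "((\<lambda>t::real. p + t *\<^sub>R V) has_derivative (\<lambda>s. s *\<^sub>R V)) (at t)" for t
    by (auto intro!: derivative_eq_intros)
  have "Cn_on n UNIV (\<lambda>t::real. p + t *\<^sub>R V)" for n
  proof (cases n)
    case 0
    then show ?thesis
      by (auto intro!: continuous_intros)
  next
    case (Suc m)
    have "frechet_derivative (\<lambda>t::real. p + t *\<^sub>R V) (at t) = (\<lambda>s. s *\<^sub>R V)" for t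
      using frechet_derivative_at[OF der] by simp
    then show ?thesis
      using der Suc by (auto simp: Cn_on_const differentiable_def)
  qed
  then show ?thesis
    by (simp add: smooth_on_def)
qed

lemma smooth_curve_affine:
  assumes "\<And>t. t \<in> {a..b} \<Longrightarrow> \<gamma> t = p + t *\<^sub>R V"
  shows "smooth_curve a b \<gamma>"
  unfolding smooth_curve_def
  by (rule exI[of _ UNIV], rule exI[of _ "\<lambda>t. p + t *\<^sub>R V"]) (simp add: assms smooth_on_affine)

lemma smooth_curve_reparametrize:
  assumes "smooth_curve (k * a + d) (k * b + d) \<gamma>" "k > 0"
    and "\<And>t. t \<in> {a..b} \<Longrightarrow> \<sigma> t = \<gamma> (k * t + d)"
  shows "smooth_curve a b \<sigma>"
proof -
  obtain U g where U: "open U" "{k * a + d..k * b + d} \<subseteq> U" "smooth_on U g"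
    "\<And>t. t \<in> {k * a + d..k * b + d} \<Longrightarrow> g t = \<gamma> t"
    using assms(1) unfolding smooth_curve_def by blast
  have im: "k * t + d \<in> {k * a + d..k * b + d}" if "t \<in> {a..b}" for t
    using that assms(2) by auto
  have "open {t. k * t + d \<in> U}"
    using open_vimage[OF U(1), of "\<lambda>t. k * t + d"] by (simp add: vimage_def continuous_intros)
  moreover have "smooth_on {t. k * t + d \<in> U} (\<lambda>t. g (k * t + d))"
    using U(1,3) Cn_on_compose_affine unfolding smooth_on_def by blast
  ultimately show ?thesis
    unfolding smooth_curve_def using U(2,4) im assms(3)
    by (intro exI[of _ "{t. k * t + d \<in> U}"] exI[of _ "\<lambda>t. g (k * t + d)"]) auto
qed

lemma smooth_curve_subinterval:
  assumes "smooth_curve a b \<gamma>" "a \<le> u" "v \<le> b"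
  shows "smooth_curve u v \<gamma>"
proof -
  have "{u..v} \<subseteq> {a..b}"
    using assms(2,3) by auto
  then show ?thesis
    using assms(1) unfolding smooth_curve_def by blast
qed

lemma smooth_curve_C1:
  assumes "smooth_curve a b \<gamma>"
  obtains \<gamma>' where "continuous_on {a..b} \<gamma>" "continuous_on {a..b} \<gamma>'"
    "\<And>t. t \<in> {a<..<b} \<Longrightarrow> (\<gamma> has_vector_derivative \<gamma>' t) (at t)"
proof -
  obtain U g where U: "open U" "{a..b} \<subseteq> U" "smooth_on U g" "\<And>t. t \<in> {a..b} \<Longrightarrow> g t = \<gamma> t"
    using assms unfolding smooth_curve_def by blast
  define g' where "g' t = frechet_derivative g (at t) 1" for t
  have C1: "Cn_on (Suc 0) U g" and C0: "Cn_on 0 U g"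
    using U(3) unfolding smooth_on_def by blast+
  have "(g has_vector_derivative g' t) (at t)" if "t \<in> U" for t
  proof -
    have D: "(g has_derivative frechet_derivative g (at t)) (at t)"
      using C1 that frechet_derivative_works by auto
    have "frechet_derivative g (at t) s = s *\<^sub>R g' t" for s
      using linear_cmul[OF has_derivative_linear[OF D], of s 1] by (simp add: g'_def)
    then have "frechet_derivative g (at t) = (\<lambda>s. s *\<^sub>R g' t)"
      by (rule ext)
    then show ?thesis
      using D by (simp add: has_vector_derivative_def)
  qed
  then have "(\<gamma> has_vector_derivative g' t) (at t)" if "t \<in> {a<..<b}" for t
    using has_vector_derivative_transform_within_open[of g "g' t" t "{a<..<b}" \<gamma>] that U(2,4)
    by (force simp: subset_eq)
  moreover have "continuous_on {a..b} g'"
    using C1 continuous_on_subset[OF _ U(2), of g'] by (simp add: g'_def[abs_def])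
  moreover have "continuous_on {a..b} \<gamma>"
    using C0 continuous_on_subset[OF _ U(2), of g] U(4) continuous_on_cong[of "{a..b}" "{a..b}" g \<gamma>]
    by simp
  ultimately show thesis
    using that by blast
qed

lemma smooth_imp_piecewise_smooth:
  assumes "smooth_curve a b \<gamma>"
  shows "piecewise_smooth a b \<gamma>"
proof -
  have "continuous_on {a..b} \<gamma>"
    using smooth_curve_C1[OF assms] by blast
  then show ?thesis
    using smooth_curve_subinterval[OF assms] unfolding piecewise_smooth_def
    by (intro conjI exI[of _ "{}"]) auto
qed

lemma piecewise_smooth_subinterval:
  assumes "piecewise_smooth a b \<gamma>" "a \<le> u" "v \<le> b"
  shows "piecewise_smooth u v \<gamma>"
proof -
  have "continuous_on {u..v} \<gamma>"
    using assms by (auto simp: piecewise_smooth_def elim!: continuous_on_subset)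
  moreover obtain S where "finite S"
    "\<And>x y. a \<le> x \<and> x < y \<and> y \<le> b \<and> {x<..<y} \<inter> S = {} \<Longrightarrow> smooth_curve x y \<gamma>"
    using assms(1) unfolding piecewise_smooth_def by blast
  ultimately show ?thesis
    unfolding piecewise_smooth_def using assms(2,3)
    by (intro conjI exI[of _ S]) auto
qed

text \<open>
  Away from finitely many times the velocity within the parameter interval is an honest two-sided
  derivative. Induction on the number of break points inside a subinterval reduces the
  integrability of the travel time integrand to the smooth pieces, where the velocity extends
  continuously to the end points.
\<close>

lemma piecewise_smooth_velocity:
  fixes F :: "real^3 \<Rightarrow> real"
  assumes ps: "piecewise_smooth a b \<gamma>" and F: "continuous_on UNIV F"
  obtains S where "finite S"
    "\<And>t. t \<in> {a<..<b} - S \<Longrightarrow>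
       (\<gamma> has_vector_derivative vector_derivative \<gamma> (at t within {a..b})) (at t)"
    "(\<lambda>t. F (vector_derivative \<gamma> (at t within {a..b}))) integrable_on {a..b}"
proof -
  obtain S where S: "finite S"
    and piece: "\<And>u v. a \<le> u \<Longrightarrow> u < v \<Longrightarrow> v \<le> b \<Longrightarrow> {u<..<v} \<inter> S = {} \<Longrightarrow> smooth_curve u v \<gamma>"
    using ps unfolding piecewise_smooth_def by blast
  let ?d = "\<lambda>t. vector_derivative \<gamma> (at t within {a..b})"
  have d_eq: "?d t = w" if "(\<gamma> has_vector_derivative w) (at t)" "a < t" "t < b" for t w
  proof -
    have "(\<gamma> has_vector_derivative w) (at t within {a..b})"
      using that(1) by (rule has_vector_derivative_at_within)
    then show ?thesis
      using that(2,3) by (intro vector_derivative_within_closed_interval) auto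
  qed
  have smooth_piece: "(\<forall>t\<in>{u<..<v}. (\<gamma> has_vector_derivative ?d t) (at t)) \<and>
      (\<lambda>t. F (?d t)) integrable_on {u..v}"
    if uv: "a \<le> u" "u < v" "v \<le> b" "{u<..<v} \<inter> S = {}" for u v
  proof -
    obtain \<gamma>' where g: "continuous_on {u..v} \<gamma>'"
      "\<And>t. t \<in> {u<..<v} \<Longrightarrow> (\<gamma> has_vector_derivative \<gamma>' t) (at t)"
      using smooth_curve_C1[OF piece[OF uv]] by blast
    have eq: "?d t = \<gamma>' t" if "t \<in> {u<..<v}" for t
      using d_eq[OF g(2)[OF that]] uv that by auto
    have "continuous_on {u..v} (\<lambda>t. F (\<gamma>' t))"
      using continuous_on_compose2[OF F g(1)] by simp
    then have "(\<lambda>t. F (\<gamma>' t)) integrable_on {u..v}"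
      by (rule integrable_continuous_real)
    then have "(\<lambda>t. F (?d t)) integrable_on {u..v}"
      by (rule integrable_spike_finite[of "{u, v}", rotated 2]) (auto simp: eq)
    then show ?thesis
      using g(2) eq by auto
  qed
  have der: "(\<gamma> has_vector_derivative ?d t) (at t)" if t: "t \<in> {a<..<b} - S" for t
  proof -
    have "open ({a<..<b} - S)"
      using S by (intro open_Diff finite_imp_closed) auto
    then obtain e where e: "e > 0" "ball t e \<subseteq> {a<..<b} - S"
      using t open_contains_ball by blast
    have sub: "{t - e<..<t + e} \<subseteq> {a<..<b} - S"
      using e(2) by (simp add: ball_eq_greaterThanLessThan)
    then have "a \<le> t - e/2" "t + e/2 \<le> b"
      using e(1) subsetD[OF sub, of "t - e/2"] subsetD[OF sub, of "t + e/2"] by auto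
    moreover have "{t - e/2<..<t + e/2} \<inter> S = {}"
      using sub e(1) greaterThanLessThan_subseteq_greaterThanLessThan[of "t - e/2" "t + e/2" "t - e" "t + e"]
      by auto
    ultimately show ?thesis
      using smooth_piece[of "t - e/2" "t + e/2"] e(1) by auto
  qed
  have int: "(\<lambda>t. F (?d t)) integrable_on {u..v}" if "a \<le> u" "u \<le> v" "v \<le> b" for u v
    using that
  proof (induction "card (S \<inter> {u<..<v})" arbitrary: u v rule: less_induct)
    case less
    show ?case
    proof (cases "S \<inter> {u<..<v} = {}")
      case True
      then show ?thesis
        using smooth_piece[of u v] less.prems integrable_on_refl[of _ u]
        by (cases "u = v") (auto simp: Int_commute box_real)
    next
      case False
      then obtain s where s: "s \<in> S" "u < s" "s < v"
        by auto
      have "card (S \<inter> {u<..<s}) < card (S \<inter> {u<..<v})"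
        "card (S \<inter> {s<..<v}) < card (S \<inter> {u<..<v})"
        using s S by (auto intro!: psubset_card_mono)
      then have "(\<lambda>t. F (?d t)) integrable_on {u..s}" "(\<lambda>t. F (?d t)) integrable_on {s..v}"
        using less.hyps[of u s] less.hyps[of s v] less.prems s by auto
      then show ?thesis
        using Henstock_Kurzweil_Integration.integrable_combine[of u s v] s by auto
    qed
  qed
  have "(\<lambda>t. F (?d t)) integrable_on {a..b}"
  proof (cases "a \<le> b")
    case True
    then show ?thesis
      using int[of a b] by simp
  next
    case False
    then show ?thesis
      using integrable_on_empty by simp
  qed
  then show thesis
    using that[OF S] der by blast
qed

section \<open>The Randers norm as a travel time under wind\<close>

text \<open>
  A linear embedding \<open>L\<close> that turns \<open>h\<close> into the Euclidean inner product makes the inequalities of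
  Euclidean geometry available for the \<open>h\<close>-norm.
\<close>

locale zermelo =
  fixes L :: "real^3 \<Rightarrow> real^3" and h :: "real^3 \<Rightarrow> real^3 \<Rightarrow> real" and W :: "real^3"
  assumes lin: "linear L" and inj: "L x = 0 \<Longrightarrow> x = 0"
    and h_eq: "h u v = L u \<bullet> L v" and mild: "h W W < 1"
begin

abbreviation F :: "real^3 \<Rightarrow> real" where "F \<equiv> randers h W"

lemmas L_simps = linear_add[OF lin] linear_diff[OF lin] linear_cmul[OF lin] linear_0[OF lin]

lemma F_formula: "F v = (sqrt ((L W \<bullet> L v)\<^sup>2 + (1 - L W \<bullet> L W) * (L v \<bullet> L v)) - L W \<bullet> L v) / (1 - L W \<bullet> L W)"
  by (simp add: randers_def Let_def h_eq)

lemma lambda_pos: "1 - L W \<bullet> L W > 0"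
  using mild by (simp add: h_eq)

lemma F_nonneg: "F v \<ge> 0"
proof -
  have "\<bar>L W \<bullet> L v\<bar> \<le> sqrt ((L W \<bullet> L v)\<^sup>2 + (1 - L W \<bullet> L W) * (L v \<bullet> L v))"
    using lambda_pos by (intro real_le_rsqrt) auto
  then show ?thesis
    using lambda_pos by (simp add: F_formula)
qed

lemma F_0 [simp]: "F 0 = 0"
  by (simp add: F_formula L_simps)

lemma h_norm_eq: "h_norm h v = norm (L v)"
  by (simp add: h_norm_def h_eq norm_eq_sqrt_inner)

lemma norm_wind: "norm (L W) < 1"
  using lambda_pos by (simp add: dot_square_norm power_less_one_iff abs_square_less_1 flip: power2_norm_eq_inner)

text \<open>
  Rationalizing the square root factors the difference of the two squares:
  \<open>\<tau>\<^sup>2 - |L (v - \<tau> W)|\<^sup>2\<close> is \<open>\<tau> - F v\<close> times a positive number.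
\<close>

lemma zermelo_factorization:
  assumes "\<tau> > 0"
  obtains k where "k > 0" "\<tau>\<^sup>2 - (norm (L (v - \<tau> *\<^sub>R W)))\<^sup>2 = (\<tau> - F v) * k"
proof -
  let ?l = "1 - L W \<bullet> L W" and ?s = "L W \<bullet> L v"
  define y where "y = sqrt (?s\<^sup>2 + ?l * (L v \<bullet> L v))"
  have y: "\<bar>?s\<bar> \<le> y" "y\<^sup>2 = ?s\<^sup>2 + ?l * (L v \<bullet> L v)"
    using lambda_pos by (auto simp: y_def intro!: real_le_rsqrt)
  have F: "F v = (y - ?s) / ?l"
    by (simp add: F_formula y_def)
  have "\<tau>\<^sup>2 - (norm (L (v - \<tau> *\<^sub>R W)))\<^sup>2 = \<tau>\<^sup>2 - (L v \<bullet> L v - 2 * \<tau> * ?s + \<tau>\<^sup>2 * (L W \<bullet> L W))"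
    unfolding power2_norm_eq_inner
    by (simp add: L_simps inner_diff_left inner_diff_right inner_commute power2_eq_square algebra_simps)
  also have "\<dots> = ((?l * \<tau> + ?s)\<^sup>2 - y\<^sup>2) / ?l"
    using lambda_pos unfolding y(2) by (simp add: field_simps power2_eq_square)
  also have "\<dots> = (\<tau> - F v) * (?l * \<tau> + ?s + y)"
    using lambda_pos unfolding F by (simp add: field_simps power2_eq_square)
  finally have "\<tau>\<^sup>2 - (norm (L (v - \<tau> *\<^sub>R W)))\<^sup>2 = (\<tau> - F v) * (?l * \<tau> + ?s + y)" .
  moreover have "?l * \<tau> > 0"
    using assms lambda_pos by simp
  then have "?l * \<tau> + ?s + y > 0"
    using y(1) by linarith
  ultimately show thesis
    using that by blast
qed

lemma F_le_iff:
  assumes "\<tau> > 0"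
  shows "F v \<le> \<tau> \<longleftrightarrow> norm (L (v - \<tau> *\<^sub>R W)) \<le> \<tau>"
proof -
  obtain k where "k > 0" "\<tau>\<^sup>2 - (norm (L (v - \<tau> *\<^sub>R W)))\<^sup>2 = (\<tau> - F v) * k"
    using zermelo_factorization[OF assms] .
  then have "(norm (L (v - \<tau> *\<^sub>R W)))\<^sup>2 \<le> \<tau>\<^sup>2 \<longleftrightarrow> F v \<le> \<tau>"
    by (metis diff_ge_0_iff_ge zero_le_mult_iff less_le_not_le)
  then show ?thesis
    using assms by (simp add: power_mono_iff)
qed

lemma F_ge_iff:
  assumes "\<tau> > 0"
  shows "\<tau> \<le> F v \<longleftrightarrow> \<tau> \<le> norm (L (v - \<tau> *\<^sub>R W))"
proof -
  obtain k where "k > 0" "\<tau>\<^sup>2 - (norm (L (v - \<tau> *\<^sub>R W)))\<^sup>2 = (\<tau> - F v) * k"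
    using zermelo_factorization[OF assms] .
  then have "\<tau>\<^sup>2 \<le> (norm (L (v - \<tau> *\<^sub>R W)))\<^sup>2 \<longleftrightarrow> \<tau> \<le> F v"
    by (metis diff_le_0_iff_le mult_le_0_iff less_le_not_le)
  then show ?thesis
    using assms by (simp add: power_mono_iff)
qed

lemma F_pos:
  assumes "v \<noteq> 0"
  shows "F v > 0"
proof -
  have "norm (L v) > 0"
    using inj assms by auto
  \<comment> \<open>So short a time that the wind, slower than 1, cannot bring \<open>v\<close> within \<open>h\<close>-distance \<open>\<tau>\<close>.\<close>
  define \<tau> where "\<tau> = norm (L v) / 3"
  have "norm (L v) \<le> norm (L (v - \<tau> *\<^sub>R W)) + \<tau> * norm (L W)"
    using norm_triangle_ineq[of "L (v - \<tau> *\<^sub>R W)" "\<tau> *\<^sub>R L W"] \<open>norm (L v) > 0\<close>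
    by (simp add: linear_diff[OF lin] linear_cmul[OF lin] \<tau>_def)
  moreover have "\<tau> * norm (L W) \<le> \<tau>"
    using norm_wind \<open>norm (L v) > 0\<close> by (intro mult_left_le) (auto simp: \<tau>_def)
  ultimately have "\<tau> \<le> norm (L (v - \<tau> *\<^sub>R W))"
    using \<open>norm (L v) > 0\<close> unfolding \<tau>_def by linarith
  then have "\<tau> \<le> F v"
    using \<open>norm (L v) > 0\<close> by (subst F_ge_iff) (auto simp: \<tau>_def)
  then show ?thesis
    using \<open>norm (L v) > 0\<close> unfolding \<tau>_def by linarith
qed

text \<open>
  Moving with velocity \<open>v\<close> at cost \<open>F v\<close> per unit of parameter means being carried by
  \<open>F v *\<^sub>R W\<close> and covering the \<open>h\<close>-length \<open>F v\<close> against the drifting medium.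
\<close>

lemma norm_drift_eq_F: "norm (L (v - F v *\<^sub>R W)) = F v"
proof (cases "v = 0")
  case False
  then show ?thesis
    using F_le_iff[OF F_pos, of v v] F_ge_iff[OF F_pos, of v v] by simp
qed (simp add: L_simps)

lemma F_eq_1_iff: "F V = 1 \<longleftrightarrow> norm (L (V - W)) = 1"
  using F_le_iff[of 1 V] F_ge_iff[of 1 V] by (auto simp: order_antisym)

lemma F_scaleR:
  assumes "k \<ge> 0"
  shows "F (k *\<^sub>R v) = k * F v"
proof -
  have "sqrt ((k * (L W \<bullet> L v))\<^sup>2 + (1 - L W \<bullet> L W) * (k * (k * (L v \<bullet> L v)))) =
      sqrt (k\<^sup>2 * ((L W \<bullet> L v)\<^sup>2 + (1 - L W \<bullet> L W) * (L v \<bullet> L v)))"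
    by (simp add: algebra_simps power2_eq_square)
  also have "\<dots> = k * sqrt ((L W \<bullet> L v)\<^sup>2 + (1 - L W \<bullet> L W) * (L v \<bullet> L v))"
    using assms by (simp add: real_sqrt_mult)
  finally show ?thesis
    by (simp add: F_formula L_simps right_diff_distrib)
qed

lemma bounded_linear_L: "bounded_linear L"
  using lin by (simp add: linear_conv_bounded_linear)

lemma continuous_F: "continuous_on UNIV F"
proof -
  have "continuous_on UNIV L"
    using bounded_linear_L by (rule linear_continuous_on)
  then show ?thesis
    unfolding F_formula using lambda_pos by (intro continuous_intros) auto
qed

text \<open>
  At a unit vector \<open>V\<close> the \<open>F\<close>-fundamental form pairs \<open>V\<close> with \<open>u\<close> to a multiple of
  \<open>h (V - W) u\<close>, so both notions of orthogonality agree there. Since \<open>F\<close> is homogeneous, its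
  derivative in the direction \<open>u\<close> vanishes all along the ray through \<open>V\<close> as soon as it does
  at \<open>V\<close>.
\<close>

lemma fundamental_form_orthogonal:
  assumes unit: "norm (L (V - W)) = 1" and orth: "h (V - W) u = 0"
  shows "half_hessian (\<lambda>x. (F x)\<^sup>2) V V u = 0"
proof -
  let ?l = "1 - L W \<bullet> L W" and ?g = "L W \<bullet> L V" and ?b = "L W \<bullet> L u"
  have VV: "L V \<bullet> L V = 2 * ?g + ?l"
  proof -
    have "(norm (L (V - W)))\<^sup>2 = 1"
      using unit by simp
    then show ?thesis
      by (simp add: power2_norm_eq_inner L_simps inner_diff_left inner_diff_right inner_commute)
  qed
  have Vu: "L V \<bullet> L u = ?b"
    using orth by (simp add: h_eq L_simps inner_diff_left)
  have pos: "?l + ?g > 0"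
  proof -
    have "\<bar>L W \<bullet> L (V - W)\<bar> \<le> norm (L W) * norm (L (V - W))"
      by (rule Cauchy_Schwarz_ineq2)
    then show ?thesis
      using norm_wind unit by (simp add: L_simps inner_diff_right)
  qed
  have inner0: "((\<lambda>s. (F (V + t *\<^sub>R V + s *\<^sub>R u))\<^sup>2) has_field_derivative 0) (at 0)"
    if "t > -1" for t
  proof -
    define k where "k = 1 + t"
    have k: "k > 0" "V + t *\<^sub>R V + s *\<^sub>R u = k *\<^sub>R V + s *\<^sub>R u" for s
      using that by (auto simp: k_def scaleR_add_left)
    let ?D = "\<lambda>s. (k * ?g + s * ?b)\<^sup>2 + ?l * (k\<^sup>2 * (2 * ?g + ?l) + 2 * k * s * ?b + s\<^sup>2 * (L u \<bullet> L u))"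
    have F: "F (V + t *\<^sub>R V + s *\<^sub>R u) = (sqrt (?D s) - (k * ?g + s * ?b)) / ?l" for s
    proof -
      have "L (k *\<^sub>R V + s *\<^sub>R u) \<bullet> L (k *\<^sub>R V + s *\<^sub>R u) =
          k\<^sup>2 * (L V \<bullet> L V) + 2 * k * s * (L V \<bullet> L u) + s\<^sup>2 * (L u \<bullet> L u)"
        by (simp add: L_simps inner_add_left inner_add_right inner_commute power2_eq_square algebra_simps)
      then show ?thesis
        unfolding k(2) F_formula by (simp add: L_simps inner_add_right VV Vu)
    qed
    have D0: "?D 0 = (k * (?l + ?g))\<^sup>2"
      by (simp add: power2_eq_square algebra_simps)
    have sD0: "sqrt (?D 0) = k * (?l + ?g)"
      unfolding D0 using k(1) pos by (simp add: real_sqrt_abs)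
    have "?D 0 > 0"
      unfolding D0 using k(1) pos by simp
    have "(?D has_field_derivative 2 * k * ?b * (?l + ?g)) (at 0)"
      by (auto intro!: derivative_eq_intros simp: algebra_simps)
    from DERIV_chain2[OF DERIV_real_sqrt[OF \<open>?D 0 > 0\<close>] this]
    have root: "((\<lambda>s. sqrt (?D s)) has_field_derivative ?b) (at 0)"
      unfolding sD0 using k(1) pos
      by (elim DERIV_cong) (simp add: divide_simps)
    have "((\<lambda>s. k * ?g + s * ?b) has_field_derivative ?b) (at 0)"
      by (auto intro!: derivative_eq_intros)
    from DERIV_cdivide[OF DERIV_diff[OF root this], of ?l]
    have "((\<lambda>s. F (V + t *\<^sub>R V + s *\<^sub>R u)) has_field_derivative 0) (at 0)"
      unfolding F by simp
    from DERIV_power[OF this, of 2] show ?thesis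
      by simp
  qed
  have "((\<lambda>t. deriv (\<lambda>s. (F (V + t *\<^sub>R V + s *\<^sub>R u))\<^sup>2) 0) has_field_derivative 0) (at 0)"
  proof (rule has_field_derivative_transform_within_open[of "\<lambda>t. 0" 0 0 "{-1<..}"])
    show "0 = deriv (\<lambda>s. (F (V + t *\<^sub>R V + s *\<^sub>R u))\<^sup>2) 0" if "t \<in> {-1<..}" for t
      using DERIV_imp_deriv[OF inner0, of t] that by simp
  qed auto
  then show ?thesis
    by (simp add: half_hessian_def DERIV_imp_deriv)
qed

section \<open>Distances along segments\<close>

text \<open>
  Seen from a frame drifting with the wind for the whole travel time \<open>\<tau>\<close>, a curve has
  \<open>h\<close>-length \<open>\<tau>\<close>; so its end points are at most \<open>\<tau>\<close> apart in that frame.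
\<close>

lemma travel_time_ge:
  assumes ps: "piecewise_smooth a b \<gamma>" and "a \<le> b"
  shows "F (\<gamma> b - \<gamma> a) \<le> travel_time F a b \<gamma>"
proof -
  let ?d = "\<lambda>t. vector_derivative \<gamma> (at t within {a..b})" and ?\<tau> = "travel_time F a b \<gamma>"
  obtain S where S: "finite S"
    "\<And>t. t \<in> {a<..<b} - S \<Longrightarrow> (\<gamma> has_vector_derivative ?d t) (at t)"
    and int: "(\<lambda>t. F (?d t)) integrable_on {a..b}"
    using piecewise_smooth_velocity[OF ps continuous_F] by blast
  have \<tau>: "((\<lambda>t. F (?d t)) has_integral ?\<tau>) {a..b}"
    using int unfolding travel_time_def by (rule integrable_integral)
  have "?\<tau> \<ge> 0"
    using has_integral_nonneg[OF \<tau>] F_nonneg by simp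
  have "(?d has_integral (\<gamma> b - \<gamma> a)) {a..b}"
    using ps S \<open>a \<le> b\<close> unfolding piecewise_smooth_def
    by (intro fundamental_theorem_of_calculus_interior_strong[of S]) auto
  from has_integral_linear[OF has_integral_diff[OF this has_integral_scaleR_left[OF \<tau>, of W]] bounded_linear_L]
  have drift: "((\<lambda>t. L (?d t - F (?d t) *\<^sub>R W)) has_integral L (\<gamma> b - \<gamma> a - ?\<tau> *\<^sub>R W)) {a..b}"
    by (simp add: o_def)
  have bound: "norm (L (\<gamma> b - \<gamma> a - ?\<tau> *\<^sub>R W)) \<le> ?\<tau>"
    using integral_norm_bound_integral[OF has_integral_integrable[OF drift] int]
    by (simp add: norm_drift_eq_F integral_unique[OF drift] integral_unique[OF \<tau>])
  show ?thesis
  proof (cases "?\<tau> = 0")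
    case True
    then have "\<gamma> b - \<gamma> a = 0"
      using bound inj[of "\<gamma> b - \<gamma> a"] by simp
    then show ?thesis
      using True by simp
  next
    case False
    then show ?thesis
      using bound \<open>?\<tau> \<ge> 0\<close> F_le_iff[of ?\<tau>] by simp
  qed
qed

lemma vector_derivative_affine:
  assumes "\<And>t. t \<in> {a..b} \<Longrightarrow> \<gamma> t = p + t *\<^sub>R V" "a < b" "t \<in> {a..b}"
  shows "(\<gamma> has_vector_derivative V) (at t within {a..b})"
proof -
  have "((\<lambda>t. p + t *\<^sub>R V) has_vector_derivative V) (at t within {a..b})"
    by (auto intro!: derivative_eq_intros)
  then show ?thesis
    using has_vector_derivative_transform[OF assms(3)] assms(1) by (metis (no_types, lifting))
qed

lemma travel_time_affine:
  assumes "\<And>t. t \<in> {a..b} \<Longrightarrow> \<gamma> t = p + t *\<^sub>R V" "a \<le> b"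
  shows "travel_time F a b \<gamma> = (b - a) * F V"
proof (cases "a = b")
  case False
  then have "a < b"
    using assms(2) by simp
  then have "vector_derivative \<gamma> (at t within {a..b}) = V" if "t \<in> {a..b}" for t
    using vector_derivative_within_closed_interval[OF \<open>a < b\<close> that
        vector_derivative_affine[OF assms(1) \<open>a < b\<close> that]] by simp
  then have "travel_time F a b \<gamma> = integral {a..b} (\<lambda>t. F V)"
    unfolding travel_time_def by (intro integral_cong) auto
  then show ?thesis
    using \<open>a < b\<close> by simp
qed (simp add: travel_time_def)

lemma F_dist_ge: "ereal (F (q - p)) \<le> F_dist M F p q"
  unfolding F_dist_def by (rule INF_greatest) (use travel_time_ge[of 0 1] in auto)

lemma F_dist_segment:
  assumes "closed_segment p q \<subseteq> M"
  shows "F_dist M F p q = ereal (F (q - p))"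
proof -
  let ?\<gamma> = "\<lambda>t::real. p + t *\<^sub>R (q - p)"
  have "?\<gamma> ` {0..1} \<subseteq> M"
    using assms by (auto simp: closed_segment_image_interval algebra_simps)
  moreover have "piecewise_smooth 0 1 ?\<gamma>"
    by (intro smooth_imp_piecewise_smooth smooth_curve_affine) simp
  moreover have "travel_time F 0 1 ?\<gamma> = F (q - p)"
    using travel_time_affine[of 0 1 ?\<gamma> p "q - p"] by simp
  ultimately have "F_dist M F p q \<le> ereal (F (q - p))"
    unfolding F_dist_def by (intro INF_lower2[of ?\<gamma>]) auto
  then show ?thesis
    using F_dist_ge by (simp add: order_antisym)
qed

text \<open>
  The triangle inequality for arrival times rests on concatenation. Both parts are run at twice
  the speed to fit into the unit interval; homogeneity of \<open>F\<close> compensates for this. The junction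
  and the halved break points of \<open>\<gamma>\<close> become break points of \<open>\<sigma>\<close>.
\<close>

lemma append_segment:
  assumes ps: "piecewise_smooth 0 1 \<gamma>" and im: "\<gamma> ` {0..1} \<subseteq> M" and "\<gamma> 1 = q"
    and seg: "closed_segment q z \<subseteq> M"
  obtains \<sigma> where "piecewise_smooth 0 1 \<sigma>" "\<sigma> ` {0..1} \<subseteq> M" "\<sigma> 0 = \<gamma> 0" "\<sigma> 1 = z"
    "travel_time F 0 1 \<sigma> = travel_time F 0 1 \<gamma> + F (z - q)"
proof -
  define \<sigma> where "\<sigma> t = (if t \<le> 1/2 then \<gamma> (2 * t) else q + (2 * t - 1) *\<^sub>R (z - q))" for t :: real
  have fst_half: "\<sigma> t = \<gamma> (2 * t)" if "t \<in> {0..1/2}" for t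
    using that by (simp add: \<sigma>_def)
  have snd_half: "\<sigma> t = (2 *\<^sub>R q - z) + t *\<^sub>R (2 *\<^sub>R (z - q))" if "t \<in> {1/2..1}" for t
  proof (cases "t = 1/2")
    case True
    then show ?thesis
      using \<open>\<gamma> 1 = q\<close> scaleR_2[of q] unfolding True by (simp add: \<sigma>_def)
  next
    case False
    have "q + (X - (z - q)) = (2 *\<^sub>R q - z) + X" for X
      by (simp add: scaleR_2)
    moreover have "(2 * t - 1) *\<^sub>R (z - q) = t *\<^sub>R (2 *\<^sub>R (z - q)) - (z - q)"
      by (simp add: scaleR_diff_left mult.commute)
    ultimately show ?thesis
      using that False by (simp only: \<sigma>_def) auto
  qed
  have cont: "continuous_on {0..1} \<sigma>"
  proof -
    have "continuous_on {0..1} \<gamma>"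
      using ps unfolding piecewise_smooth_def by blast
    then have "continuous_on {0..1/2} (\<lambda>t. \<gamma> (2 * t))"
      by (rule continuous_on_compose2) (auto intro!: continuous_intros)
    then have "continuous_on {0..1/2} \<sigma>"
      using fst_half continuous_on_cong[of "{0..1/2}" "{0..1/2}" \<sigma> "\<lambda>t. \<gamma> (2 * t)"] by blast
    moreover have "continuous_on {1/2..1} (\<lambda>t. (2 *\<^sub>R q - z) + t *\<^sub>R (2 *\<^sub>R (z - q)))"
      by (intro continuous_intros)
    then have "continuous_on {1/2..1} \<sigma>"
      using snd_half continuous_on_cong[of "{1/2..1}" "{1/2..1}" \<sigma>
          "\<lambda>t. (2 *\<^sub>R q - z) + t *\<^sub>R (2 *\<^sub>R (z - q))"] by blast
    ultimately have "continuous_on ({0..1/2} \<union> {1/2..1}) \<sigma>"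
      by (intro continuous_on_closed_Un) auto
    then show ?thesis
      by (simp add: ivl_disj_un)
  qed
  obtain S where S: "finite S"
    and piece: "\<And>u v. 0 \<le> u \<Longrightarrow> u < v \<Longrightarrow> v \<le> 1 \<Longrightarrow> {u<..<v} \<inter> S = {} \<Longrightarrow> smooth_curve u v \<gamma>"
    using ps unfolding piecewise_smooth_def by blast
  have smooth: "smooth_curve u v \<sigma>"
    if uv: "0 \<le> u" "u < v" "v \<le> 1" "{u<..<v} \<inter> insert (1/2) ((\<lambda>s. s / 2) ` S) = {}" for u v
  proof (cases "v \<le> 1/2")
    case True
    have "{2 * u<..<2 * v} \<inter> S = {}"
    proof (rule ccontr)
      assume "{2 * u<..<2 * v} \<inter> S \<noteq> {}"
      then obtain s where "s \<in> S" "2 * u < s" "s < 2 * v"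
        by auto
      then have "s / 2 \<in> {u<..<v} \<inter> insert (1/2) ((\<lambda>s. s / 2) ` S)"
        by auto
      then show False
        using uv(4) by simp
    qed
    then have "smooth_curve (2 * u) (2 * v) \<gamma>"
      using piece[of "2 * u" "2 * v"] uv True by simp
    then show ?thesis
      using smooth_curve_reparametrize[of 2 u 0 v \<gamma> \<sigma>] fst_half uv True by simp
  next
    case False
    then have "1/2 \<le> u"
      using uv by force
    then show ?thesis
      using uv by (intro smooth_curve_affine[OF snd_half]) auto
  qed
  have ps': "piecewise_smooth 0 1 \<sigma>"
    unfolding piecewise_smooth_def using cont smooth S
    by (intro conjI exI[of _ "insert (1/2) ((\<lambda>s. s / 2) ` S)"]) auto
  have im': "\<sigma> ` {0..1} \<subseteq> M"
  proof -
    have "\<sigma> t \<in> M" if t: "t \<in> {0..1}" for t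
    proof (cases "t \<le> 1/2")
      case True
      then show ?thesis
        using t im by (auto simp: \<sigma>_def image_subset_iff)
    next
      case False
      then have "\<sigma> t = (1 - (2 * t - 1)) *\<^sub>R q + (2 * t - 1) *\<^sub>R z" "0 \<le> 2 * t - 1" "2 * t - 1 \<le> 1"
        using t by (auto simp: \<sigma>_def scaleR_diff_left scaleR_diff_right scaleR_2[of q])
      then have "\<sigma> t \<in> closed_segment q z"
        unfolding closed_segment_def by blast
      then show ?thesis
        using seg by blast
    qed
    then show ?thesis
      by blast
  qed
  let ?d = "\<lambda>t. vector_derivative \<gamma> (at t within {0..1})"
    and ?e = "\<lambda>t. vector_derivative \<sigma> (at t within {0..1})"
  obtain S' where S': "finite S'"
    "\<And>t. t \<in> {0<..<1} - S' \<Longrightarrow> (\<gamma> has_vector_derivative ?d t) (at t)"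
    and int: "(\<lambda>t. F (?d t)) integrable_on {0..1}"
    using piecewise_smooth_velocity[OF ps continuous_F] by blast
  have e_eq: "?e t = w" if "(\<sigma> has_vector_derivative w) (at t)" "0 < t" "t < 1" for t w
    using that vector_derivative_within_closed_interval[of 0 1 t \<sigma> w]
    by (auto intro: has_vector_derivative_at_within)
  have "((\<lambda>t. F (?d t)) has_integral travel_time F 0 1 \<gamma>) (cbox 0 1)"
    using int unfolding travel_time_def by (simp add: integrable_integral)
  from has_integral_affinity[OF this, of 2 0]
  have "((\<lambda>t. F (?d (2 * t))) has_integral travel_time F 0 1 \<gamma> / 2) {0..1/2}"
    by (simp add: image_affinity_atLeastAtMost[of _ 0, simplified] field_simps)
  from has_integral_mult_right[OF this, of 2]
  have scaled: "((\<lambda>t. 2 * F (?d (2 * t))) has_integral travel_time F 0 1 \<gamma>) {0..1/2}"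
    by simp
  have first: "((\<lambda>t. F (?e t)) has_integral travel_time F 0 1 \<gamma>) {0..1/2}"
  proof (rule has_integral_spike_finite[OF _ _ scaled])
    show "finite ({0, 1/2} \<union> (\<lambda>s. s / 2) ` S')"
      using S'(1) by simp
    show "F (?e t) = 2 * F (?d (2 * t))" if t: "t \<in> {0..1/2} - ({0, 1/2} \<union> (\<lambda>s. s / 2) ` S')" for t
    proof -
      have "2 * t \<notin> S'"
      proof
        assume "2 * t \<in> S'"
        then have "(2 * t) / 2 \<in> (\<lambda>s. s / 2) ` S'"
          by (rule imageI)
        then show False
          using t by simp
      qed
      then have "(\<gamma> has_vector_derivative ?d (2 * t)) (at (2 * t))"
        using S'(2)[of "2 * t"] t by auto
      moreover have "((\<lambda>t. 2 * t) has_vector_derivative 2) (at t)"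
        by (auto intro!: derivative_eq_intros)
      ultimately have "((\<gamma> \<circ> (\<lambda>t. 2 * t)) has_vector_derivative 2 *\<^sub>R ?d (2 * t)) (at t)"
        using vector_diff_chain_at[of "\<lambda>t. 2 * t" 2 t \<gamma>] by simp
      then have "(\<sigma> has_vector_derivative 2 *\<^sub>R ?d (2 * t)) (at t)"
        by (rule has_vector_derivative_transform_within_open[of _ _ _ "{0<..<1/2}"])
          (use t in \<open>auto simp: fst_half\<close>)
      then have "?e t = 2 *\<^sub>R ?d (2 * t)"
        using e_eq t by auto
      then show ?thesis
        by (simp add: F_scaleR)
    qed
  qed
  have "((\<lambda>t. F (2 *\<^sub>R (z - q))) has_integral F (z - q)) {1/2..1::real}"
    using has_integral_const_real[of "F (2 *\<^sub>R (z - q))" "1/2" 1] by (simp add: F_scaleR)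
  then have second: "((\<lambda>t. F (?e t)) has_integral F (z - q)) {1/2..1}"
  proof (rule has_integral_spike_finite[rotated 2])
    show "finite {1/2, 1::real}"
      by simp
    show "F (?e t) = F (2 *\<^sub>R (z - q))" if t: "t \<in> {1/2..1} - {1/2, 1}" for t
    proof -
      have "((\<lambda>t. (2 *\<^sub>R q - z) + t *\<^sub>R (2 *\<^sub>R (z - q))) has_vector_derivative 2 *\<^sub>R (z - q)) (at t)"
        by (auto intro!: derivative_eq_intros)
      then have "(\<sigma> has_vector_derivative 2 *\<^sub>R (z - q)) (at t)"
        by (rule has_vector_derivative_transform_within_open[of _ _ _ "{1/2<..<1}"])
          (use t in \<open>auto simp: snd_half\<close>)
      then have "?e t = 2 *\<^sub>R (z - q)"
        using e_eq t by auto
      then show ?thesis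
        by simp
    qed
  qed
  have "((\<lambda>t. F (?e t)) has_integral (travel_time F 0 1 \<gamma> + F (z - q))) {0..1}"
    by (rule has_integral_combine[OF _ _ first second]) auto
  then have "travel_time F 0 1 \<sigma> = travel_time F 0 1 \<gamma> + F (z - q)"
    unfolding travel_time_def[of F 0 1 \<sigma>] by (rule integral_unique)
  moreover have "\<sigma> 0 = \<gamma> 0" "\<sigma> 1 = z"
    by (auto simp: \<sigma>_def)
  ultimately show thesis
    using that ps' im' by blast
qed

lemma arrival_time_segment:
  assumes "closed_segment q z \<subseteq> M"
  shows "arrival_time M F A z \<le> arrival_time M F A q + ereal (F (z - q))"
proof -
  let ?k = "F (z - q)"
  have "F_dist M F p z - ereal ?k \<le> F_dist M F p q" for p
    unfolding F_dist_def[of M F p q]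
  proof (rule INF_greatest)
    fix \<gamma> assume "\<gamma> \<in> {\<gamma>. piecewise_smooth 0 1 \<gamma> \<and> \<gamma> ` {0..1} \<subseteq> M \<and> \<gamma> 0 = p \<and> \<gamma> 1 = q}"
    then have \<gamma>: "piecewise_smooth 0 1 \<gamma>" "\<gamma> ` {0..1} \<subseteq> M" "\<gamma> 0 = p" "\<gamma> 1 = q"
      by auto
    obtain \<sigma> where "piecewise_smooth 0 1 \<sigma>" "\<sigma> ` {0..1} \<subseteq> M" "\<sigma> 0 = p" "\<sigma> 1 = z"
      "travel_time F 0 1 \<sigma> = travel_time F 0 1 \<gamma> + ?k"
      using append_segment[OF \<gamma>(1,2,4) assms] \<gamma>(3) by metis
    then have "F_dist M F p z \<le> ereal (travel_time F 0 1 \<gamma> + ?k)"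
      unfolding F_dist_def by (intro INF_lower2[of \<sigma>]) auto
    then show "F_dist M F p z - ereal ?k \<le> ereal (travel_time F 0 1 \<gamma>)"
      by (subst ereal_minus_le) auto
  qed
  then have "arrival_time M F A z - ereal ?k \<le> arrival_time M F A q"
    unfolding arrival_time_def[of M F A q]
    by (intro INF_greatest, subst ereal_minus_le)
      (auto simp: arrival_time_def ereal_minus_le intro: INF_lower2)
  then show ?thesis
    by (subst (asm) ereal_minus_le) auto
qed

end

section \<open>Wave rays are orthogonal straight lines\<close>

locale fire = zermelo +
  fixes M A :: "(real^3) set"
  assumes open_M: "open M" and A_subset: "A \<subseteq> M"
begin

lemma unit_speed_travel_time:
  assumes "unit_speed F T \<gamma>" "piecewise_smooth 0 T \<gamma>" "0 \<le> s" "s \<le> u" "u \<le> T"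
  shows "travel_time F s u \<gamma> = u - s"
proof -
  let ?d = "\<lambda>t. vector_derivative \<gamma> (at t within {s..u})"
  have ps: "piecewise_smooth s u \<gamma>"
    using assms piecewise_smooth_subinterval by blast
  obtain S where S: "finite S"
    "\<And>t. t \<in> {s<..<u} - S \<Longrightarrow> (\<gamma> has_vector_derivative ?d t) (at t)"
    using piecewise_smooth_velocity[OF ps continuous_F] by blast
  have speed: "F (?d t) = 1" if "t \<in> {s<..<u} - S" for t
  proof -
    have "t \<in> {0..T}"
      using assms that by auto
    then show ?thesis
      using has_vector_derivative_at_within[OF S(2)[OF that], of "{0..T}"] \<open>unit_speed F T \<gamma>\<close>
      unfolding unit_speed_def by blast
  qed
  have "((\<lambda>t. 1::real) has_integral (u - s)) {s..u}"
    using has_integral_const_real[of "1::real" s u] \<open>s \<le> u\<close> by simp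
  then have "((\<lambda>t. F (?d t)) has_integral (u - s)) {s..u}"
    by (rule has_integral_spike_finite[of "{s, u} \<union> S", rotated 2]) (use S(1) speed in auto)
  then show ?thesis
    unfolding travel_time_def by (rule integral_unique)
qed

text \<open>
  In the drifting frame a wave ray is a local isometry of the line: its unit speed bounds the
  displacement from above, and a shortcut along a segment inside \<open>M\<close> would let the fire arrive
  too early.
\<close>

lemma wave_ray_local_isometry:
  assumes ray: "wave_ray M F A T \<gamma>" and t: "t \<in> {0..T}"
  obtains \<delta> where "\<delta> > 0"
    "\<And>s u. s \<in> {0..T} \<Longrightarrow> u \<in> {0..T} \<Longrightarrow> \<bar>s - t\<bar> < \<delta> \<Longrightarrow> \<bar>u - t\<bar> < \<delta> \<Longrightarrow> s < u \<Longrightarrow>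
       norm (L (\<gamma> u - \<gamma> s - (u - s) *\<^sub>R W)) = u - s"
proof -
  have ps: "piecewise_smooth 0 T \<gamma>" and im: "\<gamma> ` {0..T} \<subseteq> M" and us: "unit_speed F T \<gamma>"
    and arr: "\<And>t. t \<in> {0..T} \<Longrightarrow> arrival_time M F A (\<gamma> t) = ereal t"
    using ray unfolding wave_ray_def by auto
  obtain e where e: "e > 0" "ball (\<gamma> t) e \<subseteq> M"
    using open_M im t open_contains_ball by blast
  have "continuous_on {0..T} \<gamma>"
    using ps unfolding piecewise_smooth_def by blast
  then obtain \<delta> where \<delta>: "\<delta> > 0" "\<And>s. s \<in> {0..T} \<Longrightarrow> dist s t < \<delta> \<Longrightarrow> dist (\<gamma> s) (\<gamma> t) < e"
    using t e(1) unfolding continuous_on_iff by blast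
  have "norm (L (\<gamma> u - \<gamma> s - (u - s) *\<^sub>R W)) = u - s"
    if su: "s \<in> {0..T}" "u \<in> {0..T}" "\<bar>s - t\<bar> < \<delta>" "\<bar>u - t\<bar> < \<delta>" "s < u" for s u
  proof (rule order_antisym)
    have "F (\<gamma> u - \<gamma> s) \<le> travel_time F s u \<gamma>"
      using su piecewise_smooth_subinterval[OF ps] by (intro travel_time_ge) auto
    also have "\<dots> = u - s"
      using su us ps by (intro unit_speed_travel_time) auto
    finally show "norm (L (\<gamma> u - \<gamma> s - (u - s) *\<^sub>R W)) \<le> u - s"
      using F_le_iff[of "u - s"] su(5) by simp
    have "\<gamma> s \<in> ball (\<gamma> t) e" "\<gamma> u \<in> ball (\<gamma> t) e"
      using \<delta>(2)[of s] \<delta>(2)[of u] su by (simp_all add: dist_real_def dist_commute)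
    then have "closed_segment (\<gamma> s) (\<gamma> u) \<subseteq> M"
      using closed_segment_subset[OF _ _ convex_ball] e(2) by blast
    from arrival_time_segment[OF this, of A] have "u - s \<le> F (\<gamma> u - \<gamma> s)"
      using arr su by simp
    then show "u - s \<le> norm (L (\<gamma> u - \<gamma> s - (u - s) *\<^sub>R W))"
      using F_ge_iff[of "u - s"] su(5) by simp
  qed
  then show thesis
    using that \<delta>(1) by blast
qed

text \<open>
  Euclidean space is strictly convex, so a curve that is locally an isometry of the line is
  locally affine; then its velocity is locally constant, hence constant on the whole interval.
\<close>

lemma wave_ray_affine:
  assumes ray: "wave_ray M F A T \<gamma>" and "T > 0"
  obtains V where "\<And>t. t \<in> {0..T} \<Longrightarrow> \<gamma> t = \<gamma> 0 + t *\<^sub>R V"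
proof -
  define d where "d t = vector_derivative \<gamma> (at t within {0..T})" for t
  have local: "\<exists>\<epsilon>>0. \<exists>V. \<forall>m\<in>{0..T}. \<bar>m - t\<bar> < \<epsilon> \<longrightarrow> (\<gamma> has_vector_derivative V) (at m within {0..T})"
    if t: "t \<in> {0..T}" for t
  proof -
    obtain \<delta> where \<delta>: "\<delta> > 0"
      and iso: "\<And>s u. s \<in> {0..T} \<Longrightarrow> u \<in> {0..T} \<Longrightarrow> \<bar>s - t\<bar> < \<delta> \<Longrightarrow> \<bar>u - t\<bar> < \<delta> \<Longrightarrow> s < u \<Longrightarrow>
         norm (L (\<gamma> u - \<gamma> s - (u - s) *\<^sub>R W)) = u - s"
      using wave_ray_local_isometry[OF ray t] by blast
    define \<alpha> \<beta> where "\<alpha> = max 0 (t - \<delta>/2)" and "\<beta> = min T (t + \<delta>/2)"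
    have ab: "\<alpha> \<in> {0..T}" "\<beta> \<in> {0..T}" "\<bar>\<alpha> - t\<bar> < \<delta>" "\<bar>\<beta> - t\<bar> < \<delta>" "\<alpha> < \<beta>"
      using t \<delta> \<open>T > 0\<close> by (auto simp: \<alpha>_def \<beta>_def)
    define V where "V = (1 / (\<beta> - \<alpha>)) *\<^sub>R (\<gamma> \<beta> - \<gamma> \<alpha>)"
    have affine: "\<gamma> m = (\<gamma> \<alpha> - \<alpha> *\<^sub>R V) + m *\<^sub>R V" if m: "m \<in> {\<alpha>..\<beta>}" for m
    proof -
      have "(\<beta> - \<alpha>) *\<^sub>R (\<gamma> m - \<gamma> \<alpha>) = (m - \<alpha>) *\<^sub>R (\<gamma> \<beta> - \<gamma> \<alpha>)"
      proof (cases "m = \<alpha> \<or> m = \<beta>")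
        case False
        then have m': "\<alpha> < m" "m < \<beta>" "m \<in> {0..T}" "\<bar>m - t\<bar> < \<delta>"
          using m ab by auto
        define x y where "x = \<gamma> m - \<gamma> \<alpha> - (m - \<alpha>) *\<^sub>R W" and "y = \<gamma> \<beta> - \<gamma> m - (\<beta> - m) *\<^sub>R W"
        have xy: "x + y = \<gamma> \<beta> - \<gamma> \<alpha> - (\<beta> - \<alpha>) *\<^sub>R W"
          by (simp add: x_def y_def algebra_simps)
        have n: "norm (L x) = m - \<alpha>" "norm (L y) = \<beta> - m" "norm (L (x + y)) = \<beta> - \<alpha>"
          unfolding xy unfolding x_def y_def using iso m' ab by auto
        \<comment> \<open>Equality in the triangle inequality makes the two displacements parallel.\<close>
        then have "norm (L x + L y) = norm (L x) + norm (L y)"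
          by (simp add: L_simps)
        then have "norm (L x) *\<^sub>R L y = norm (L y) *\<^sub>R L x"
          by (simp add: norm_triangle_eq)
        then have "L ((m - \<alpha>) *\<^sub>R y - (\<beta> - m) *\<^sub>R x) = 0"
          by (simp add: n L_simps)
        then have "(m - \<alpha>) *\<^sub>R y - (\<beta> - m) *\<^sub>R x = 0"
          by (rule inj)
        then show ?thesis
          unfolding x_def y_def by (simp add: algebra_simps)
      qed auto
      then have "\<gamma> m - \<gamma> \<alpha> = (m - \<alpha>) *\<^sub>R V"
        using ab(5) unfolding V_def
        by (metis (no_types, lifting) divideR_right mult.commute scaleR_scaleR inverse_eq_divide
            less_irrefl right_minus_eq scaleR_left_commute)
      then show ?thesis
        by (simp add: algebra_simps)
    qed
    have der: "(\<gamma> has_vector_derivative V) (at m within {0..T})"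
      if m: "m \<in> {0..T}" "\<bar>m - t\<bar> < \<delta>/4" for m
    proof -
      have "((\<lambda>m. (\<gamma> \<alpha> - \<alpha> *\<^sub>R V) + m *\<^sub>R V) has_vector_derivative V) (at m within {0..T})"
        by (auto intro!: derivative_eq_intros)
      then show ?thesis
      proof (rule has_vector_derivative_transform_within[where d = "\<delta>/4"])
        show "(\<gamma> \<alpha> - \<alpha> *\<^sub>R V) + x *\<^sub>R V = \<gamma> x" if "x \<in> {0..T}" "dist x m < \<delta>/4" for x
        proof -
          have "\<bar>x - t\<bar> \<le> \<delta>/2"
            using that(2) m(2) unfolding dist_real_def by linarith
          then have "x \<in> {\<alpha>..\<beta>}"
            using that(1) unfolding \<alpha>_def \<beta>_def abs_le_iff by simp
          then show ?thesis
            by (rule affine[symmetric])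
        qed
      qed (use m \<delta> in auto)
    qed
    show ?thesis
      by (intro exI[of _ "\<delta>/4"] conjI exI[of _ V]) (use \<delta> der in auto)
  qed
  have d: "d t = V" if "(\<gamma> has_vector_derivative V) (at t within {0..T})" "t \<in> {0..T}" for t V
    using vector_derivative_within_closed_interval[OF \<open>T > 0\<close> that(2,1)] by (simp add: d_def)
  have der: "(\<gamma> has_vector_derivative d t) (at t within {0..T})" if t: "t \<in> {0..T}" for t
  proof -
    obtain V where "(\<gamma> has_vector_derivative V) (at t within {0..T})"
      using local[OF t] t by (metis abs_zero diff_self)
    then show ?thesis
      using d t by metis
  qed
  have const: "d t = d 0" if t: "t \<in> {0..T}" for t
  proof (rule connected_local_const[of "{0..T}"])
    show "\<forall>a\<in>{0..T}. \<forall>\<^sub>F b in at a within {0..T}. d a = d b"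
    proof
      fix a assume a: "a \<in> {0..T}"
      obtain \<epsilon> V where "\<epsilon> > 0"
        and V: "\<And>m. m \<in> {0..T} \<Longrightarrow> \<bar>m - a\<bar> < \<epsilon> \<Longrightarrow> (\<gamma> has_vector_derivative V) (at m within {0..T})"
        using local[OF a] by blast
      have dV: "d m = V" if "m \<in> {0..T}" "\<bar>m - a\<bar> < \<epsilon>" for m
        using d[OF V[OF that] that(1)] .
      have "d a = d m" if "m \<in> {0..T}" "dist m a < \<epsilon>" for m
        using dV[of m] dV[of a] that a \<open>\<epsilon> > 0\<close> by (simp add: dist_real_def)
      then show "\<forall>\<^sub>F b in at a within {0..T}. d a = d b"
        using \<open>\<epsilon> > 0\<close> by (auto simp: eventually_at)
    qed
  qed (use t \<open>T > 0\<close> in auto)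
  have "((\<lambda>t. \<gamma> t - t *\<^sub>R d 0) has_vector_derivative 0) (at t within {0..T})" if t: "t \<in> {0..T}" for t
    using der[OF t] unfolding const[OF t] by (auto intro!: derivative_eq_intros)
  from has_vector_derivative_zero_constant[OF _ this]
  obtain c where c: "\<And>t. t \<in> {0..T} \<Longrightarrow> \<gamma> t - t *\<^sub>R d 0 = c"
    by auto
  have "\<gamma> t = \<gamma> 0 + t *\<^sub>R d 0" if "t \<in> {0..T}" for t
    using c[OF that] c[of 0] \<open>T > 0\<close> by (simp add: algebra_simps)
  then show thesis
    using that by blast
qed

text \<open>
  For a short time \<open>t\<close> the point \<open>p + t V\<close> is joined inside \<open>M\<close> to every point of \<open>A\<close> near
  \<open>p\<close> by a segment, and none of these is a faster approach than the ray itself. So \<open>p\<close> is a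
  point of \<open>A\<close> locally \<open>h\<close>-nearest to \<open>p + t (V - W)\<close>, the centre being shifted by the wind,
  and the first variation along \<open>A\<close> vanishes.
\<close>

lemma wave_ray_orthogonal:
  assumes "T > 0" and aff: "\<And>t. t \<in> {0..T} \<Longrightarrow> \<gamma> t = p + t *\<^sub>R V"
    and arr: "\<And>t. t \<in> {0..T} \<Longrightarrow> arrival_time M F A (\<gamma> t) = ereal t"
    and "p \<in> A" and unit: "norm (L (V - W)) = 1"
  shows "h_orthogonal h A p (V - W)"
  unfolding h_orthogonal_def
proof
  fix u assume "u \<in> tangent_space A p"
  then obtain \<epsilon> c where c: "\<epsilon> > 0" "c ` {-\<epsilon><..<\<epsilon>} \<subseteq> A" "c 0 = p" "(c has_vector_derivative u) (at 0)"
    unfolding tangent_space_def by blast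
  obtain e where e: "e > 0" "ball p e \<subseteq> M"
    using open_M \<open>p \<in> A\<close> A_subset open_contains_ball by blast
  define t where "t = min T (e / (2 * (norm V + 1)))"
  have t: "0 < t" "t \<le> T"
    using \<open>T > 0\<close> e(1) by (auto simp: t_def add_nonneg_pos)
  have "t * norm V \<le> e / (2 * (norm V + 1)) * (norm V + 1)"
    using e(1) t by (intro mult_mono) (auto simp: t_def)
  also have "\<dots> = e / 2"
    using norm_ge_zero[of V] by (simp add: field_simps add_nonneg_eq_0_iff)
  finally have x: "p + t *\<^sub>R V \<in> ball p e"
    using e(1) t by (simp add: dist_norm)
  have "isCont c 0"
    using c(4) has_vector_derivative_continuous by blast
  then obtain \<delta> where \<delta>: "\<delta> > 0" "\<And>s. dist s 0 < \<delta> \<Longrightarrow> dist (c s) (c 0) < e"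
    using e(1) unfolding continuous_at_eps_delta by blast
  define g where "g s = L (p + t *\<^sub>R V - c s - t *\<^sub>R W)" for s
  have far: "t \<le> norm (g s)" if "\<bar>s\<bar> < min \<delta> \<epsilon>" for s
  proof -
    have "c s \<in> ball p e"
      using \<delta>(2)[of s] that c(3) by (simp add: dist_commute)
    then have seg: "closed_segment (c s) (p + t *\<^sub>R V) \<subseteq> M"
      using closed_segment_subset[OF _ x convex_ball] e(2) by blast
    have "c s \<in> A"
      using that by (intro subsetD[OF c(2)] imageI) (auto simp: abs_less_iff)
    then have "arrival_time M F A (p + t *\<^sub>R V) \<le> F_dist M F (c s) (p + t *\<^sub>R V)"
      unfolding arrival_time_def by (rule INF_lower)
    then have "t \<le> F (p + t *\<^sub>R V - c s)"
      using arr[of t] aff[of t] t by (simp add: F_dist_segment[OF seg])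
    then show ?thesis
      using F_ge_iff[OF t(1)] by (simp add: g_def)
  qed
  have g0: "g 0 = t *\<^sub>R L (V - W)"
    using c(3) by (simp add: g_def flip: scaleR_diff_right linear_cmul[OF lin])
  have "((\<lambda>s. p + t *\<^sub>R V - c s - t *\<^sub>R W) has_vector_derivative - u) (at 0)"
    using c(4) by (auto intro!: derivative_eq_intros)
  then have "(g has_vector_derivative L (- u)) (at 0)"
    unfolding g_def by (rule bounded_linear.has_vector_derivative[OF bounded_linear_L])
  from bounded_bilinear.has_vector_derivative[OF bounded_bilinear_inner this this]
  have der: "((\<lambda>s. g s \<bullet> g s) has_field_derivative 2 * (g 0 \<bullet> L (- u))) (at 0)"
    by (simp add: has_real_derivative_iff_has_vector_derivative inner_commute)
  have "2 * (g 0 \<bullet> L (- u)) = 0"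
  proof (rule DERIV_local_min[OF der])
    show "0 < min \<delta> \<epsilon>"
      using \<delta>(1) c(1) by simp
    show "\<forall>s. \<bar>0 - s\<bar> < min \<delta> \<epsilon> \<longrightarrow> g 0 \<bullet> g 0 \<le> g s \<bullet> g s"
    proof (intro allI impI)
      fix s assume "\<bar>0 - s\<bar> < min \<delta> \<epsilon>"
      then have "norm (g 0) \<le> norm (g s)"
        using far[of s] g0 unit t(1) by simp
      then show "g 0 \<bullet> g 0 \<le> g s \<bullet> g s"
        by (simp add: norm_le)
    qed
  qed
  then show "h (V - W) u = 0"
    using t(1) by (simp add: g0 h_eq linear_neg[OF lin])
qed

lemma wave_ray_imp_orthogonal_line:
  assumes ray: "wave_ray M F A T \<gamma>" and "T > 0"
  obtains V where "\<gamma> 0 \<in> A" "h_norm h (V - W) = 1" "h_orthogonal h A (\<gamma> 0) (V - W)"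
    "\<And>t. t \<in> {0..T} \<Longrightarrow> \<gamma> t = \<gamma> 0 + t *\<^sub>R V"
proof -
  obtain V where V: "\<And>t. t \<in> {0..T} \<Longrightarrow> \<gamma> t = \<gamma> 0 + t *\<^sub>R V"
    using wave_ray_affine[OF assms] by blast
  have "F V = 1"
    using ray vector_derivative_affine[OF V \<open>T > 0\<close>, of 0] \<open>T > 0\<close>
    unfolding wave_ray_def unit_speed_def by auto
  then have unit: "norm (L (V - W)) = 1"
    by (simp add: F_eq_1_iff)
  have "\<gamma> 0 \<in> A"
    using ray by (simp add: wave_ray_def)
  moreover have "h_orthogonal h A (\<gamma> 0) (V - W)"
    using ray wave_ray_orthogonal[OF \<open>T > 0\<close> V _ \<open>\<gamma> 0 \<in> A\<close> unit] by (simp add: wave_ray_def)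
  moreover have "h_norm h (V - W) = 1"
    using unit by (simp add: h_norm_eq)
  ultimately show thesis
    using that V by blast
qed

lemma wave_ray_affineI:
  assumes "T > 0" "p \<in> A" and unit: "h_norm h (V - W) = 1"
    and line: "\<And>t. t \<in> {0..T} \<Longrightarrow> p + t *\<^sub>R V \<in> M \<and> arrival_time M F A (p + t *\<^sub>R V) = ereal t"
    and \<gamma>: "\<And>t. t \<in> {0..T} \<Longrightarrow> \<gamma> t = p + t *\<^sub>R V"
  shows "wave_ray M F A T \<gamma>"
proof -
  have "F v = 1" if "t \<in> {0..T}" "(\<gamma> has_vector_derivative v) (at t within {0..T})" for t v
  proof -
    have "v = V"
      using vector_derivative_within_closed_interval[OF \<open>T > 0\<close> that]
        vector_derivative_within_closed_interval[OF \<open>T > 0\<close> that(1)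
          vector_derivative_affine[OF \<gamma> \<open>T > 0\<close> that(1)]] by simp
    then show ?thesis
      using unit by (simp add: F_eq_1_iff h_norm_eq)
  qed
  then have "unit_speed F T \<gamma>"
    unfolding unit_speed_def by blast
  moreover have "piecewise_smooth 0 T \<gamma>"
    by (intro smooth_imp_piecewise_smooth smooth_curve_affine[OF \<gamma>])
  moreover have "\<gamma> 0 \<in> A"
    using \<gamma>[of 0] assms by simp
  moreover have "\<gamma> ` {0..T} \<subseteq> M" "\<forall>t\<in>{0..T}. arrival_time M F A (\<gamma> t) = ereal t"
    using \<gamma> line by auto
  ultimately show ?thesis
    unfolding wave_ray_def by blast
qed

lemma short_orthogonal_geodesic:
  assumes "p \<in> A" and unit: "h_norm h (V - W) = 1" and orth: "h_orthogonal h A p (V - W)"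
  obtains \<epsilon> where "\<epsilon> > 0" "orthogonal_geodesic M F A \<epsilon> (\<lambda>t. p + t *\<^sub>R V)"
proof -
  let ?\<gamma> = "\<lambda>t::real. p + t *\<^sub>R V"
  have unit': "norm (L (V - W)) = 1" "F V = 1"
    using unit by (auto simp: h_norm_eq F_eq_1_iff)
  obtain e where e: "e > 0" "ball p e \<subseteq> M"
    using open_M \<open>p \<in> A\<close> A_subset open_contains_ball by blast
  define \<epsilon> where "\<epsilon> = e / (2 * (norm V + 1))"
  have \<epsilon>: "\<epsilon> > 0"
    using e(1) by (simp add: \<epsilon>_def add_nonneg_pos)
  have in_ball: "?\<gamma> t \<in> ball p e" if "t \<in> {0..\<epsilon>}" for t
  proof -
    have "t * norm V \<le> \<epsilon> * (norm V + 1)"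
      using that \<epsilon> by (intro mult_mono) auto
    also have "\<dots> = e / 2"
      using norm_ge_zero[of V] by (simp add: \<epsilon>_def field_simps add_nonneg_eq_0_iff)
    finally show ?thesis
      using e(1) that by (simp add: dist_norm)
  qed
  have "F_dist M F (?\<gamma> s) (?\<gamma> u) = ereal (travel_time F s u ?\<gamma>)"
    if "s \<in> {0..\<epsilon>}" "u \<in> {0..\<epsilon>}" "s \<le> u" for s u
  proof -
    have "closed_segment (?\<gamma> s) (?\<gamma> u) \<subseteq> M"
      using closed_segment_subset[OF in_ball[OF that(1)] in_ball[OF that(2)] convex_ball] e(2) by blast
    moreover have "?\<gamma> u - ?\<gamma> s = (u - s) *\<^sub>R V"
      by (simp add: algebra_simps)
    ultimately show ?thesis
      using travel_time_affine[of s u ?\<gamma> p V] that(3) F_scaleR[of "u - s" V]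
      by (simp add: F_dist_segment)
  qed
  moreover have "?\<gamma> ` {0..\<epsilon>} \<subseteq> M"
    using in_ball e(2) by blast
  moreover have "smooth_curve 0 \<epsilon> ?\<gamma>"
    by (rule smooth_curve_affine) simp
  ultimately have geo: "F_geodesic M F \<epsilon> ?\<gamma>"
    unfolding F_geodesic_def by (intro conjI ballI exI[of _ 1]) auto
  have der: "vector_derivative ?\<gamma> (at t within {0..\<epsilon>}) = V" if "t \<in> {0..\<epsilon>}" for t
    using vector_derivative_within_closed_interval[OF \<epsilon> that
        vector_derivative_affine[OF refl \<epsilon> that, of p V]] .
  have speed: "unit_speed F \<epsilon> ?\<gamma>"
    unfolding unit_speed_def
    using der vector_derivative_within_closed_interval[OF \<epsilon>] unit'(2) by metis
  have "V \<noteq> 0"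
    using unit'(2) F_0 by auto
  then have "F_orthogonal F A p V"
    using orth fundamental_form_orthogonal[OF unit'(1)]
    unfolding F_orthogonal_def h_orthogonal_def by blast
  then have "orthogonal_geodesic M F A \<epsilon> ?\<gamma>"
    unfolding orthogonal_geodesic_def using geo speed \<open>p \<in> A\<close> der[of 0] \<epsilon> by simp
  then show thesis
    using that \<epsilon> by blast
qed

lemma no_cut_locus_continue:
  assumes "no_cut_locus M F A r" "\<epsilon> > 0" "orthogonal_geodesic M F A \<epsilon> \<gamma>"
  obtains \<sigma> where "orthogonal_geodesic M F A r \<sigma>"
    "\<And>t. t \<in> {0..min \<epsilon> r} \<Longrightarrow> \<sigma> t = \<gamma> t"
    "\<And>t. t \<in> {0..r} \<Longrightarrow> arrival_time M F A (\<sigma> t) = ereal t"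
proof -
  obtain \<sigma> where "orthogonal_geodesic M F A r \<sigma>" "\<forall>t\<in>{0..min \<epsilon> r}. \<sigma> t = \<gamma> t"
    "\<forall>t\<in>{0..r}. arrival_time M F A (\<sigma> t) = ereal t"
    using assms(1)[unfolded no_cut_locus_def, THEN conjunct1, rule_format, OF assms(2,3)] by blast
  then show thesis
    using that by blast
qed

lemma no_cut_locus_unique:
  assumes "no_cut_locus M F A r" "0 < \<tau>" "\<tau> \<le> r" "q \<in> wavefront M F A \<tau>"
  obtains \<gamma> where "orthogonal_geodesic M F A r \<gamma>" "\<gamma> \<tau> = q"
    "\<forall>\<sigma>. orthogonal_geodesic M F A r \<sigma> \<and> \<sigma> \<tau> = q \<longrightarrow> (\<forall>t\<in>{0..r}. \<sigma> t = \<gamma> t)"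
proof -
  obtain \<gamma> where "orthogonal_geodesic M F A r \<gamma>" "\<gamma> \<tau> = q"
    "\<forall>\<sigma>. orthogonal_geodesic M F A r \<sigma> \<and> \<sigma> \<tau> = q \<longrightarrow> (\<forall>t\<in>{0..r}. \<sigma> t = \<gamma> t)"
    using assms(1)[unfolded no_cut_locus_def, THEN conjunct2, rule_format, of \<tau> q] assms(2-4)
    by blast
  then show thesis
    using that by blast
qed

lemma orthogonal_geodesic_imp_wave_ray:
  assumes "orthogonal_geodesic M F A r \<sigma>"
    and "\<And>t. t \<in> {0..r} \<Longrightarrow> arrival_time M F A (\<sigma> t) = ereal t"
  shows "wave_ray M F A r \<sigma>"
  unfolding wave_ray_def
  using assms smooth_imp_piecewise_smooth by (simp add: orthogonal_geodesic_def F_geodesic_def)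

text \<open>
  An orthogonal line is a geodesic for a short time. Before the cut locus it continues to a wave
  ray, which is again affine and so is the same line.
\<close>

lemma orthogonal_line_no_cut_locus:
  assumes ncl: "no_cut_locus M F A r" and "r > 0"
    and p: "p \<in> A" and unit: "h_norm h (V - W) = 1" and orth: "h_orthogonal h A p (V - W)"
  shows "\<exists>\<sigma>. orthogonal_geodesic M F A r \<sigma> \<and> (\<forall>t\<in>{0..r}. \<sigma> t = p + t *\<^sub>R V)"
    and "\<forall>t\<in>{0..r}. p + t *\<^sub>R V \<in> M \<and> arrival_time M F A (p + t *\<^sub>R V) = ereal t"
proof -
  obtain \<epsilon> where \<epsilon>: "\<epsilon> > 0" "orthogonal_geodesic M F A \<epsilon> (\<lambda>t. p + t *\<^sub>R V)"
    using short_orthogonal_geodesic[OF p unit orth] .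
  then obtain \<sigma> where \<sigma>: "orthogonal_geodesic M F A r \<sigma>"
    "\<And>t. t \<in> {0..min \<epsilon> r} \<Longrightarrow> \<sigma> t = p + t *\<^sub>R V"
    "\<And>t. t \<in> {0..r} \<Longrightarrow> arrival_time M F A (\<sigma> t) = ereal t"
    using no_cut_locus_continue[OF ncl] by blast
  have "wave_ray M F A r \<sigma>"
    using \<sigma>(1,3) by (rule orthogonal_geodesic_imp_wave_ray)
  then obtain V' where V': "\<And>t. t \<in> {0..r} \<Longrightarrow> \<sigma> t = \<sigma> 0 + t *\<^sub>R V'"
    using wave_ray_affine[OF _ \<open>r > 0\<close>] by blast
  have "\<sigma> 0 = p"
    using \<sigma>(2)[of 0] \<epsilon>(1) \<open>r > 0\<close> by simp
  moreover have "\<sigma> (min \<epsilon> r) = p + min \<epsilon> r *\<^sub>R V" "\<sigma> (min \<epsilon> r) = \<sigma> 0 + min \<epsilon> r *\<^sub>R V'"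
    using \<sigma>(2)[of "min \<epsilon> r"] V'[of "min \<epsilon> r"] \<epsilon>(1) \<open>r > 0\<close> by simp_all
  ultimately have "V' = V"
    using \<epsilon>(1) \<open>r > 0\<close> by (auto simp: min_def split: if_splits)
  then have line: "\<sigma> t = p + t *\<^sub>R V" if "t \<in> {0..r}" for t
    using V'[OF that] \<open>\<sigma> 0 = p\<close> by simp
  have "\<sigma> ` {0..r} \<subseteq> M"
    using \<sigma>(1) by (simp add: orthogonal_geodesic_def F_geodesic_def)
  then have "p + t *\<^sub>R V \<in> M \<and> arrival_time M F A (p + t *\<^sub>R V) = ereal t" if "t \<in> {0..r}" for t
    using line[OF that] \<sigma>(3)[OF that] that image_subset_iff[of \<sigma> "{0..r}" M] by metis
  then show "\<forall>t\<in>{0..r}. p + t *\<^sub>R V \<in> M \<and> arrival_time M F A (p + t *\<^sub>R V) = ereal t"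
    by blast
  show "\<exists>\<sigma>. orthogonal_geodesic M F A r \<sigma> \<and> (\<forall>t\<in>{0..r}. \<sigma> t = p + t *\<^sub>R V)"
    using \<sigma>(1) line by blast
qed

lemma wave_ray_iff_orthogonal_line:
  assumes "no_cut_locus M F A r" "0 < T" "T \<le> r"
  shows "wave_ray M F A T \<gamma> \<longleftrightarrow>
    (\<exists>p V. p \<in> A \<and> h_norm h (V - W) = 1 \<and> h_orthogonal h A p (V - W) \<and>
      (\<forall>t\<in>{0..T}. \<gamma> t = p + t *\<^sub>R V))"
proof
  assume "wave_ray M F A T \<gamma>"
  then show "\<exists>p V. p \<in> A \<and> h_norm h (V - W) = 1 \<and> h_orthogonal h A p (V - W) \<and>
      (\<forall>t\<in>{0..T}. \<gamma> t = p + t *\<^sub>R V)"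
    using wave_ray_imp_orthogonal_line[OF _ assms(2)] by metis
next
  assume "\<exists>p V. p \<in> A \<and> h_norm h (V - W) = 1 \<and> h_orthogonal h A p (V - W) \<and>
      (\<forall>t\<in>{0..T}. \<gamma> t = p + t *\<^sub>R V)"
  then obtain p V where pV: "p \<in> A" "h_norm h (V - W) = 1" "h_orthogonal h A p (V - W)"
    "\<forall>t\<in>{0..T}. \<gamma> t = p + t *\<^sub>R V"
    by blast
  have "0 < r"
    using assms(2,3) by simp
  note line = orthogonal_line_no_cut_locus(2)[OF assms(1) \<open>0 < r\<close> pV(1-3)]
  show "wave_ray M F A T \<gamma>"
  proof (rule wave_ray_affineI[OF assms(2) pV(1,2)])
    show "p + t *\<^sub>R V \<in> M \<and> arrival_time M F A (p + t *\<^sub>R V) = ereal t" if "t \<in> {0..T}" for t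
      using that assms(3) by (intro bspec[OF line]) simp
    show "\<gamma> t = p + t *\<^sub>R V" if "t \<in> {0..T}" for t
      using pV(4) that by blast
  qed
qed

section \<open>Strategic paths\<close>

lemma strategic_path_iff:
  assumes ncl: "no_cut_locus M F A r" and T: "0 < T" "T \<le> r"
  shows "strategic_path M F A T \<gamma> \<longleftrightarrow>
    (\<exists>p V. p \<in> A \<and> h_norm h (V - W) = 1 \<and> h_orthogonal h A p (V - W) \<and>
       (\<forall>p' V'. p' \<in> A \<and> h_norm h (V' - W) = 1 \<and> h_orthogonal h A p' (V' - W) \<longrightarrow>
          norm V' \<le> norm V) \<and>
       (\<forall>t\<in>{0..T}. \<gamma> t = p + t *\<^sub>R V))" (is "_ \<longleftrightarrow> ?R")
proof -
  note iff = wave_ray_iff_orthogonal_line[OF ncl T]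
  have vel: "w = V" if "\<forall>t\<in>{0..T}. \<sigma> t = p + t *\<^sub>R V" "t \<in> {0..T}"
      "(\<sigma> has_vector_derivative w) (at t within {0..T})" for \<sigma> :: "real \<Rightarrow> real^3" and p V t w
  proof -
    have "(\<sigma> has_vector_derivative V) (at t within {0..T})"
      by (rule vector_derivative_affine[OF bspec[OF that(1)] \<open>0 < T\<close> that(2)])
    then show ?thesis
      using vector_derivative_within_closed_interval[OF \<open>0 < T\<close> that(2)] that(3) by metis
  qed
  show ?thesis
  proof
    assume sp: "strategic_path M F A T \<gamma>"
    then obtain p V where pV: "p \<in> A" "h_norm h (V - W) = 1" "h_orthogonal h A p (V - W)"
      "\<forall>t\<in>{0..T}. \<gamma> t = p + t *\<^sub>R V"
      using iff[of \<gamma>] unfolding strategic_path_def by blast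
    have "norm V' \<le> norm V"
      if V': "p' \<in> A" "h_norm h (V' - W) = 1" "h_orthogonal h A p' (V' - W)" for p' V'
    proof -
      have "wave_ray M F A T (\<lambda>t. p' + t *\<^sub>R V')"
        using iff V' by blast
      moreover have "(\<gamma> has_vector_derivative V) (at 0 within {0..T})"
        "((\<lambda>t. p' + t *\<^sub>R V') has_vector_derivative V') (at 0 within {0..T})"
        using vector_derivative_affine[of 0 T \<gamma> p V 0]
          vector_derivative_affine[of 0 T "\<lambda>t. p' + t *\<^sub>R V'" p' V' 0] pV(4) \<open>0 < T\<close> by auto
      moreover have "(0::real) \<in> {0..T}"
        using \<open>0 < T\<close> by simp
      ultimately show ?thesis
        using sp unfolding strategic_path_def by blast
    qed
    then show ?R
      using pV by blast
  next
    assume ?R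
    then obtain p V where pV: "p \<in> A" "h_norm h (V - W) = 1" "h_orthogonal h A p (V - W)"
      "\<forall>t\<in>{0..T}. \<gamma> t = p + t *\<^sub>R V"
      and max: "\<And>p' V'. p' \<in> A \<Longrightarrow> h_norm h (V' - W) = 1 \<Longrightarrow> h_orthogonal h A p' (V' - W) \<Longrightarrow>
          norm V' \<le> norm V"
      by blast
    have "norm w \<le> norm v"
      if \<sigma>: "wave_ray M F A T \<sigma>" and t: "t \<in> {0..T}"
        and vw: "(\<gamma> has_vector_derivative v) (at t within {0..T})"
          "(\<sigma> has_vector_derivative w) (at t within {0..T})" for \<sigma> t v w
    proof -
      obtain p' V' where "p' \<in> A" "h_norm h (V' - W) = 1" "h_orthogonal h A p' (V' - W)"
        "\<forall>t\<in>{0..T}. \<sigma> t = p' + t *\<^sub>R V'"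
        using iff[of \<sigma>] \<sigma> by blast
      then show ?thesis
        using vel[OF pV(4) t vw(1)] vel[of \<sigma> p' V', OF _ t vw(2)] max by blast
    qed
    moreover have "wave_ray M F A T \<gamma>"
      using iff pV by blast
    ultimately show "strategic_path M F A T \<gamma>"
      unfolding strategic_path_def by blast
  qed
qed

text \<open>
  Existence: the geodesic that the standing hypothesis provides is a wave ray, hence an orthogonal
  line. Uniqueness: two orthogonal lines through \<open>q\<close> at time \<open>\<tau>\<close> are geodesics without cut points, which the
  standing hypothesis identifies.
\<close>

lemma unique_ray_velocity:
  assumes ncl: "no_cut_locus M F A r" and q: "q \<in> wavefront M F A \<tau>" and \<tau>: "0 < \<tau>" "\<tau> \<le> r"
  shows "\<exists>!V. q - \<tau> *\<^sub>R V \<in> A \<and> h_norm h (V - W) = 1 \<and> h_orthogonal h A (q - \<tau> *\<^sub>R V) (V - W)"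
proof (rule ex_ex1I)
  have "0 < r"
    using \<tau> by simp
  obtain \<gamma> where \<gamma>: "orthogonal_geodesic M F A r \<gamma>" "\<gamma> \<tau> = q"
    using no_cut_locus_unique[OF ncl \<tau> q] by metis
  obtain \<sigma> where \<sigma>: "\<And>t. t \<in> {0..min r r} \<Longrightarrow> \<sigma> t = \<gamma> t" "orthogonal_geodesic M F A r \<sigma>"
    "\<And>t. t \<in> {0..r} \<Longrightarrow> arrival_time M F A (\<sigma> t) = ereal t"
    using no_cut_locus_continue[OF ncl \<open>0 < r\<close> \<gamma>(1)] by metis
  have "wave_ray M F A r \<sigma>"
    using \<sigma>(2,3) by (rule orthogonal_geodesic_imp_wave_ray)
  then obtain V where V: "\<sigma> 0 \<in> A" "h_norm h (V - W) = 1" "h_orthogonal h A (\<sigma> 0) (V - W)"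
    "\<And>t. t \<in> {0..r} \<Longrightarrow> \<sigma> t = \<sigma> 0 + t *\<^sub>R V"
    using wave_ray_imp_orthogonal_line[OF _ \<open>0 < r\<close>] by blast
  have "q = \<sigma> 0 + \<tau> *\<^sub>R V"
    using V(4)[of \<tau>] \<sigma>(1) \<gamma>(2) \<tau> by simp
  then have "\<sigma> 0 = q - \<tau> *\<^sub>R V"
    by simp
  then show "\<exists>V. q - \<tau> *\<^sub>R V \<in> A \<and> h_norm h (V - W) = 1 \<and> h_orthogonal h A (q - \<tau> *\<^sub>R V) (V - W)"
    using V(1-3) by metis
next
  fix V V'
  assume asm: "q - \<tau> *\<^sub>R V \<in> A \<and> h_norm h (V - W) = 1 \<and> h_orthogonal h A (q - \<tau> *\<^sub>R V) (V - W)"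
    "q - \<tau> *\<^sub>R V' \<in> A \<and> h_norm h (V' - W) = 1 \<and> h_orthogonal h A (q - \<tau> *\<^sub>R V') (V' - W)"
  have "0 < r"
    using \<tau> by simp
  obtain \<gamma> where "orthogonal_geodesic M F A r \<gamma>" "\<gamma> \<tau> = q"
    and uniq: "\<forall>\<sigma>. orthogonal_geodesic M F A r \<sigma> \<and> \<sigma> \<tau> = q \<longrightarrow> (\<forall>t\<in>{0..r}. \<sigma> t = \<gamma> t)"
    using no_cut_locus_unique[OF ncl \<tau> q] .
  have start: "\<gamma> 0 = q - \<tau> *\<^sub>R X"
    if X: "q - \<tau> *\<^sub>R X \<in> A \<and> h_norm h (X - W) = 1 \<and> h_orthogonal h A (q - \<tau> *\<^sub>R X) (X - W)" for X
  proof -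
    obtain \<sigma> where \<sigma>: "orthogonal_geodesic M F A r \<sigma>"
      "\<forall>t\<in>{0..r}. \<sigma> t = (q - \<tau> *\<^sub>R X) + t *\<^sub>R X"
      using orthogonal_line_no_cut_locus(1)[OF ncl \<open>0 < r\<close>, of "q - \<tau> *\<^sub>R X" X] X by blast
    have "\<sigma> \<tau> = q"
      using bspec[OF \<sigma>(2), of \<tau>] \<tau> by simp
    then have "\<forall>t\<in>{0..r}. \<sigma> t = \<gamma> t"
      using uniq \<sigma>(1) by blast
    then have "\<sigma> 0 = \<gamma> 0"
      using \<open>0 < r\<close> by simp
    then show ?thesis
      using bspec[OF \<sigma>(2), of 0] \<open>0 < r\<close> by simp
  qed
  have "q - \<tau> *\<^sub>R V = q - \<tau> *\<^sub>R V'"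
    using start[OF asm(1)] start[OF asm(2)] by (rule trans[OF sym])
  then show "V = V'"
    using \<tau>(1) by simp
qed

lemma wave_ray_ending_iff:
  assumes "no_cut_locus M F A r" "0 < \<tau>" "\<tau> \<le> r"
  shows "wave_ray M F A \<tau> \<gamma> \<and> \<gamma> \<tau> = q \<longleftrightarrow>
    (\<exists>V. q - \<tau> *\<^sub>R V \<in> A \<and> h_norm h (V - W) = 1 \<and> h_orthogonal h A (q - \<tau> *\<^sub>R V) (V - W) \<and>
      (\<forall>t\<in>{0..\<tau>}. \<gamma> t = q + (t - \<tau>) *\<^sub>R V))" (is "_ \<longleftrightarrow> ?R")
proof -
  have shift: "(q - \<tau> *\<^sub>R V) + t *\<^sub>R V = q + (t - \<tau>) *\<^sub>R V" for V t
    by (simp add: algebra_simps)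
  show ?thesis
  proof
    assume asm: "wave_ray M F A \<tau> \<gamma> \<and> \<gamma> \<tau> = q"
    then obtain p V where pV: "p \<in> A" "h_norm h (V - W) = 1" "h_orthogonal h A p (V - W)"
      "\<forall>t\<in>{0..\<tau>}. \<gamma> t = p + t *\<^sub>R V"
      using wave_ray_iff_orthogonal_line[OF assms] by blast
    have "q = p + \<tau> *\<^sub>R V"
      using asm pV(4) \<open>0 < \<tau>\<close> by auto
    then have "p = q - \<tau> *\<^sub>R V"
      by simp
    then show ?R
      using pV shift by metis
  next
    assume ?R
    then obtain V where V: "q - \<tau> *\<^sub>R V \<in> A" "h_norm h (V - W) = 1"
      "h_orthogonal h A (q - \<tau> *\<^sub>R V) (V - W)" "\<forall>t\<in>{0..\<tau>}. \<gamma> t = q + (t - \<tau>) *\<^sub>R V"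
      by blast
    then have "wave_ray M F A \<tau> \<gamma>"
      using wave_ray_iff_orthogonal_line[OF assms, of \<gamma>] shift by metis
    moreover have "\<gamma> \<tau> = q"
      using V(4) \<open>0 < \<tau>\<close> by simp
    ultimately show "wave_ray M F A \<tau> \<gamma> \<and> \<gamma> \<tau> = q"
      by blast
  qed
qed

lemma strategic_path_to_point_iff:
  assumes "no_cut_locus M F A r" "q \<in> wavefront M F A \<tau>" "0 < \<tau>" "\<tau> \<le> r"
  shows "strategic_path_to_point M F A q \<tau> \<gamma> \<longleftrightarrow>
    (\<exists>V. q - \<tau> *\<^sub>R V \<in> A \<and> h_norm h (V - W) = 1 \<and> h_orthogonal h A (q - \<tau> *\<^sub>R V) (V - W) \<and>
      (\<forall>t\<in>{0..\<tau>}. \<gamma> t = q + (t - \<tau>) *\<^sub>R V))"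
  unfolding strategic_path_to_point_def wave_ray_ending_iff[OF assms(1,3,4), symmetric]
  using assms(2) by blast

lemma strategic_path_to_area_iff:
  assumes "no_cut_locus M F A r" "first_contact M F A B \<tau>" "0 < \<tau>" "\<tau> \<le> r"
  shows "strategic_path_to_area M F A B \<tau> \<gamma> \<longleftrightarrow>
    (\<exists>q V. q \<in> wavefront M F A \<tau> \<inter> frontier B \<and>
      q - \<tau> *\<^sub>R V \<in> A \<and> h_norm h (V - W) = 1 \<and> h_orthogonal h A (q - \<tau> *\<^sub>R V) (V - W) \<and>
      (\<forall>t\<in>{0..\<tau>}. \<gamma> t = q + (t - \<tau>) *\<^sub>R V))" (is "_ \<longleftrightarrow> ?R")
proof -
  have front: "\<gamma> \<tau> \<in> wavefront M F A \<tau>" if "wave_ray M F A \<tau> \<gamma>"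
    using that \<open>0 < \<tau>\<close> by (auto simp: wave_ray_def wavefront_def)
  have "strategic_path_to_area M F A B \<tau> \<gamma> \<longleftrightarrow>
      (\<exists>q. q \<in> wavefront M F A \<tau> \<inter> frontier B \<and> wave_ray M F A \<tau> \<gamma> \<and> \<gamma> \<tau> = q)"
    unfolding strategic_path_to_area_def using assms(2) front by blast
  also have "\<dots> \<longleftrightarrow> ?R"
    unfolding wave_ray_ending_iff[OF assms(1,3,4)] by blast
  finally show ?thesis .
qed

end

section \<open>The ellipsoidal metric\<close>

definition ellipsoid_map :: "real \<Rightarrow> real \<Rightarrow> real \<Rightarrow> real \<Rightarrow> real^3 \<Rightarrow> real^3" where
  "ellipsoid_map a b c \<alpha> x = vector [x$1 / a, (x$2 * cos \<alpha> - x$3 * sin \<alpha>) / b,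
     (x$2 * sin \<alpha> + x$3 * cos \<alpha>) / c]"

lemma ellipsoid_metric_eq:
  "ellipsoid_metric a b c \<alpha> u v = ellipsoid_map a b c \<alpha> u \<bullet> ellipsoid_map a b c \<alpha> v"
  unfolding ellipsoid_metric_def half_hessian_Q_h
  by (simp add: ellipsoid_map_def inner_vec_def sum_3)

lemma linear_ellipsoid_map: "linear (ellipsoid_map a b c \<alpha>)"
  by (rule linearI)
    (simp_all add: ellipsoid_map_def vec_eq_iff forall_3 add_divide_distrib diff_divide_distrib
      algebra_simps)

lemma ellipsoid_map_eq_0:
  assumes "a > 0" "b > 0" "c > 0" "ellipsoid_map a b c \<alpha> x = 0"
  shows "x = 0"
proof -
  have "x$1 = 0" and eqs: "x$2 * cos \<alpha> - x$3 * sin \<alpha> = 0" "x$2 * sin \<alpha> + x$3 * cos \<alpha> = 0"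
    using assms by (auto simp: ellipsoid_map_def vec_eq_iff forall_3)
  have "(x$2)\<^sup>2 + (x$3)\<^sup>2 = ((x$2)\<^sup>2 + (x$3)\<^sup>2) * ((sin \<alpha>)\<^sup>2 + (cos \<alpha>)\<^sup>2)"
    by simp
  also have "\<dots> = (x$2 * cos \<alpha> - x$3 * sin \<alpha>)\<^sup>2 + (x$2 * sin \<alpha> + x$3 * cos \<alpha>)\<^sup>2"
    by algebra
  finally show ?thesis
    using \<open>x$1 = 0\<close> by (simp add: eqs vec_eq_iff forall_3 sum_power2_eq_zero_iff)
qed

lemma norm_le_iff_sum_squares:
  fixes x y :: "real^3"
  shows "norm x \<le> norm y \<longleftrightarrow> (x$1)^2 + (x$2)^2 + (x$3)^2 \<le> (y$1)^2 + (y$2)^2 + (y$3)^2"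
  by (simp add: norm_le inner_vec_def sum_3 power2_eq_square)

theorem proposition1:
  fixes a b c \<alpha> r :: real and W :: "real^3" and M A :: "(real^3) set"
    and h :: "real^3 \<Rightarrow> real^3 \<Rightarrow> real" and F :: "real^3 \<Rightarrow> real"
  assumes "open M"
    and "a > 0" and "b > 0" and "c > 0"
    and "h = ellipsoid_metric a b c \<alpha>"
    and "W $ 1 = 0" and "h W W < 1"
    and "F = randers h W"
    and "A \<noteq> {}" and "compact A" and "smooth_submanifold M A"
    and "r > 0" and "no_cut_locus M F A r"
  shows
    "(\<forall>T \<gamma>. 0 < T \<and> T \<le> r \<longrightarrow>
        (strategic_path M F A T \<gamma> \<longleftrightarrow>
          (\<exists>p V. p \<in> A \<and> h_norm h (V - W) = 1 \<and> h_orthogonal h A p (V - W) \<and>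
             (\<forall>p' V'. p' \<in> A \<and> h_norm h (V' - W) = 1 \<and> h_orthogonal h A p' (V' - W) \<longrightarrow>
                (V'$1)^2 + (V'$2)^2 + (V'$3)^2 \<le> (V$1)^2 + (V$2)^2 + (V$3)^2) \<and>
             (\<forall>t\<in>{0..T}. \<gamma> t = p + t *\<^sub>R V)))) \<and>
     (\<forall>q \<tau>. q \<in> wavefront M F A \<tau> \<and> 0 < \<tau> \<and> \<tau> \<le> r \<longrightarrow>
        (\<exists>!V. q - \<tau> *\<^sub>R V \<in> A \<and> h_norm h (V - W) = 1 \<and>
              h_orthogonal h A (q - \<tau> *\<^sub>R V) (V - W)) \<and>
        (\<forall>\<gamma>. strategic_path_to_point M F A q \<tau> \<gamma> \<longleftrightarrow>
          (\<exists>V. q - \<tau> *\<^sub>R V \<in> A \<and> h_norm h (V - W) = 1 \<and>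
               h_orthogonal h A (q - \<tau> *\<^sub>R V) (V - W) \<and>
               (\<forall>t\<in>{0..\<tau>}. \<gamma> t = q + (t - \<tau>) *\<^sub>R V)))) \<and>
     (\<forall>B \<tau>. B \<subseteq> M \<and> first_contact M F A B \<tau> \<and> 0 < \<tau> \<and> \<tau> \<le> r \<longrightarrow>
        (\<forall>q \<in> wavefront M F A \<tau> \<inter> frontier B.
          \<exists>!V. q - \<tau> *\<^sub>R V \<in> A \<and> h_norm h (V - W) = 1 \<and>
               h_orthogonal h A (q - \<tau> *\<^sub>R V) (V - W)) \<and>
        (\<forall>\<gamma>. strategic_path_to_area M F A B \<tau> \<gamma> \<longleftrightarrow>
          (\<exists>q V. q \<in> wavefront M F A \<tau> \<inter> frontier B \<and>
               q - \<tau> *\<^sub>R V \<in> A \<and> h_norm h (V - W) = 1 \<and>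
               h_orthogonal h A (q - \<tau> *\<^sub>R V) (V - W) \<and>
               (\<forall>t\<in>{0..\<tau>}. \<gamma> t = q + (t - \<tau>) *\<^sub>R V))))"
proof -
  note h = \<open>h = ellipsoid_metric a b c \<alpha>\<close> and F = \<open>F = randers h W\<close>
  have "linear (ellipsoid_map a b c \<alpha>)"
    by (rule linear_ellipsoid_map)
  interpret fire "ellipsoid_map a b c \<alpha>" h W M A
  proof (intro fire.intro zermelo.intro fire_axioms.intro)
    show "ellipsoid_map a b c \<alpha> x = 0 \<Longrightarrow> x = 0" for x
      using ellipsoid_map_eq_0 \<open>a > 0\<close> \<open>b > 0\<close> \<open>c > 0\<close> by blast
    show "A \<subseteq> M"
      using \<open>smooth_submanifold M A\<close> by (simp add: smooth_submanifold_def)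
    show "h u v = ellipsoid_map a b c \<alpha> u \<bullet> ellipsoid_map a b c \<alpha> v" for u v
      unfolding h by (rule ellipsoid_metric_eq)
  qed fact+
  note ncl = \<open>no_cut_locus M F A r\<close>[unfolded F]
  show ?thesis
    unfolding F norm_le_iff_sum_squares[symmetric]
    using strategic_path_iff[OF ncl] unique_ray_velocity[OF ncl]
      strategic_path_to_point_iff[OF ncl] strategic_path_to_area_iff[OF ncl]
    by (intro conjI allI impI ballI) (simp_all only: Int_iff)
qed

end
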